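(* Let $n,p,q$ be positive integers, let $V=\mathrm M_{n,p}\oplus\mathrm M_{n,q}$, and let $$\Delta_{\mathfrak u'^+}=\prod_{\alpha\in\Phi'^+_{\mathrm{nc}}}(1-e^{-\alpha}),$$ where $$\Phi'^+_{\mathrm{nc}}=\{\epsilon_i-\epsilon_{p+k}:1\le i\le p,1\le k\le n\}\cup\{\epsilon_{p+k}-\epsilon_{p+n+j}:1\le k\le n,1\le j\le q\}.$$ Then, as a character of $\mathfrak m'$, $$(\Delta_{\mathfrak u'^+})^{-1}=\mathrm{ch}\,\mathbb C[V].$$
   Context: Let $\mathfrak g'=\mathfrak{sl}_{n+p+q}(\mathbb C)$ with diagonal Cartan subalgebra $\mathfrak h$, diagonal coordinates $\epsilon_1,\dots,\epsilon_{n+p+q}$, and positive roots $\epsilon_i-\epsilon_j$ ($i<j$). Let $\mathfrak k'=\mathfrak s(\mathfrak{gl}_n\oplus\mathfrak{gl}_{p+q})$, with $\mathfrak{gl}_n$ in rows and columns $p+1,\dots,p+n$ and $\mathfrak{gl}_{p+q}$ in the remaining rows and columns. A root is noncompact if its root space does not lie in $\mathfrak k'$; $\Phi'^+_{\mathrm{nc}}$ is the set of positive noncompact roots, and $\mathfrak u'^+\cong\mathrm M_{p,n}\oplus\mathrm M_{n,q}$ is the sum of their root spaces. Let $\mathfrak m'\subset\mathfrak k'$ be the Levi subalgebra $\mathfrak s(\mathfrak{gl}_n\oplus\mathfrak{gl}_p\oplus\mathfrak{gl}_q)$ of traceless block-diagonal matrices with diagonal blocks of sizes $p,n,q$ (in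 this order). $\mathrm M_{a,b}$ is the space of complex $a\times b$ matrices. The group $\mathrm{GL}_n\times\mathrm{GL}_p\times\mathrm{GL}_q$ acts on $V$ by $(g_n,g_p,g_q)\cdot(X,Y)=(g_n^{-T}Xg_p^{-1},\,g_nYg_q^{-1})$ ($g^{-T}$ is the inverse transpose), and on the polynomial ring $\mathbb C[V]$ by $(g\cdot f)(v)=f(g^{-1}\cdot v)$. To regard $\mathbb C[V]$ as an $\mathfrak m'$-module, the $\mathfrak{gl}_p$ summand is embedded in the upper-left block via negative transpose: the block matrix $\mathrm{diag}(B_p,B_n,B_q)\in\mathfrak m'$ acts through the derived action of $(B_n,-B_p^T,B_q)\in\mathfrak{gl}_n\oplus\mathfrak{gl}_p\oplus\mathfrak{gl}_q$. For an $\mathfrak m'$-module $L$ that is a direct sum of finite-dimensional $\mathfrak h$-weight spaces $L_\xi$, $\mathrm{ch}\,L=\sum_\xi\dim(L_\xi)\,e^\xi$. Identities and inverses are in the ring of formal series in the $e^{-\alpha}$, $\alpha$ a positive root of $\mathfrak g'$. *)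

theory Defs
  imports
    "Jordan_Normal_Form.Gauss_Jordan_Elimination"
    "HOL-Analysis.Derivative"
    "HOL-Library.Function_Algebras"
    "HOL-Algebra.Ring"
    "HOL-Algebra.FiniteProduct"
begin

section \<open>Traceless matrices, weights and roots\<close>

definition tr :: "complex mat \<Rightarrow> complex" where
  "tr A = (\<Sum>i<dim_row A. A $$ (i,i))"

definition sl :: "nat \<Rightarrow> complex mat set" where
  "sl N = {A \<in> carrier_mat N N. tr A = 0}"

definition cartan :: "nat \<Rightarrow> complex mat set" where
  "cartan N = {A \<in> sl N. diagonal_mat A}"

text \<open>A weight is a linear functional on the Cartan subalgebra. It is represented by a function on
  all matrices which vanishes off the Cartan subalgebra, so that equality of functions is equality
  of functionals. In particular the sum of all \<open>eps N i\<close> is zero.\<close>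

type_synonym weight = "complex mat \<Rightarrow> complex"

definition weights :: "nat \<Rightarrow> weight set" where
  "weights N = {\<xi>.
     (\<forall>A\<in>cartan N. \<forall>B\<in>cartan N. \<xi> (A + B) = \<xi> A + \<xi> B) \<and>
     (\<forall>c. \<forall>A\<in>cartan N. \<xi> (c \<cdot>\<^sub>m A) = c * \<xi> A) \<and>
     (\<forall>A. A \<notin> cartan N \<longrightarrow> \<xi> A = 0)}"

text \<open>Diagonal coordinates are numbered from 1, matrix entries from 0.\<close>

definition eps :: "nat \<Rightarrow> nat \<Rightarrow> weight" where
  "eps N i = (\<lambda>H. if H \<in> cartan N then H $$ (i - 1, i - 1) else 0)"

definition pos_roots :: "nat \<Rightarrow> weight set" where
  "pos_roots N = {eps N i - eps N j | i j. 1 \<le> i \<and> i < j \<and> j \<le> N}"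

definition root_space :: "nat \<Rightarrow> weight \<Rightarrow> complex mat set" where
  "root_space N \<alpha> = {X \<in> sl N. \<forall>H\<in>cartan N. H * X - X * H = \<alpha> H \<cdot>\<^sub>m X}"

text \<open>The subalgebra \<open>\<kk>'\<close>: an entry may be nonzero only if its row and its column both
  belong to the middle block of size \<open>n\<close>, or both belong to its complement.\<close>

definition compact_subalgebra :: "nat \<Rightarrow> nat \<Rightarrow> nat \<Rightarrow> complex mat set" where
  "compact_subalgebra n p q = {X \<in> sl (n + p + q). \<forall>i<n+p+q. \<forall>j<n+p+q.
     (i \<in> {p..<p+n}) \<noteq> (j \<in> {p..<p+n}) \<longrightarrow> X $$ (i,j) = 0}"

definition noncompact_pos_roots :: "nat \<Rightarrow> nat \<Rightarrow> nat \<Rightarrow> weight set" where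
  "noncompact_pos_roots n p q =
     {\<alpha> \<in> pos_roots (n + p + q). \<not> root_space (n + p + q) \<alpha> \<subseteq> compact_subalgebra n p q}"

definition levi :: "nat \<Rightarrow> nat \<Rightarrow> nat \<Rightarrow> complex mat set" where
  "levi n p q = {diag_block_mat [Bp, Bn, Bq] | Bp Bn Bq.
     Bp \<in> carrier_mat p p \<and> Bn \<in> carrier_mat n n \<and> Bq \<in> carrier_mat q q \<and>
     tr (diag_block_mat [Bp, Bn, Bq]) = 0}"


section \<open>The coordinate ring and its module structure\<close>

definition V :: "nat \<Rightarrow> nat \<Rightarrow> nat \<Rightarrow> (complex mat \<times> complex mat) set" where
  "V n p q = carrier_mat n p \<times> carrier_mat n q"

text \<open>Polynomials on \<open>V\<close> are represented by polynomial functions (the field is infinite), which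
  are made unique as functions on all pairs of matrices by letting them vanish off \<open>V\<close>.\<close>

type_synonym fun_V = "complex mat \<times> complex mat \<Rightarrow> complex"

inductive_set poly_V :: "nat \<Rightarrow> nat \<Rightarrow> nat \<Rightarrow> fun_V set" for n p q :: nat where
  const: "(\<lambda>v. if v \<in> V n p q then c else 0) \<in> poly_V n p q"
| coord_X: "k < n \<Longrightarrow> i < p \<Longrightarrow> (\<lambda>v. if v \<in> V n p q then fst v $$ (k,i) else 0) \<in> poly_V n p q"
| coord_Y: "k < n \<Longrightarrow> j < q \<Longrightarrow> (\<lambda>v. if v \<in> V n p q then snd v $$ (k,j) else 0) \<in> poly_V n p q"
| add: "f \<in> poly_V n p q \<Longrightarrow> g \<in> poly_V n p q \<Longrightarrow> (\<lambda>v. f v + g v) \<in> poly_V n p q"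
| mult: "f \<in> poly_V n p q \<Longrightarrow> g \<in> poly_V n p q \<Longrightarrow> (\<lambda>v. f v * g v) \<in> poly_V n p q"

definition minv :: "complex mat \<Rightarrow> complex mat" where
  "minv A = the (mat_inverse A)"

definition mexp :: "complex mat \<Rightarrow> complex mat" where
  "mexp A = Matrix.mat (dim_row A) (dim_row A) (\<lambda>(i,j). \<Sum>k. (A ^\<^sub>m k) $$ (i,j) / fact k)"

text \<open>Triples of matrices are in the order \<open>(g\<^sub>n, g\<^sub>p, g\<^sub>q)\<close>.\<close>

type_synonym mat_triple = "complex mat \<times> complex mat \<times> complex mat"

fun inv_triple :: "mat_triple \<Rightarrow> mat_triple" where
  "inv_triple (gn, gp, gq) = (minv gn, minv gp, minv gq)"

fun act_V :: "mat_triple \<Rightarrow> complex mat \<times> complex mat \<Rightarrow> complex mat \<times> complex mat" where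
  "act_V (gn, gp, gq) (X, Y) = (transpose_mat (minv gn) * X * minv gp, gn * Y * minv gq)"

definition act_poly :: "nat \<Rightarrow> nat \<Rightarrow> nat \<Rightarrow> mat_triple \<Rightarrow> fun_V \<Rightarrow> fun_V" where
  "act_poly n p q g f = (\<lambda>v. if v \<in> V n p q then f (act_V (inv_triple g) v) else 0)"

text \<open>The derived action, \<open>(B \<cdot> f)(v) = d/dt (exp(tB) \<cdot> f)(v)\<close> at \<open>t = 0\<close>.\<close>

fun derived_act :: "nat \<Rightarrow> nat \<Rightarrow> nat \<Rightarrow> mat_triple \<Rightarrow> fun_V \<Rightarrow> fun_V" where
  "derived_act n p q (Bn, Bp, Bq) f =
     (\<lambda>v. deriv (\<lambda>t. act_poly n p q (mexp (t \<cdot>\<^sub>m Bn), mexp (t \<cdot>\<^sub>m Bp), mexp (t \<cdot>\<^sub>m Bq)) f v) 0)"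

definition diag_block :: "nat \<Rightarrow> nat \<Rightarrow> complex mat \<Rightarrow> complex mat" where
  "diag_block s m M = Matrix.mat m m (\<lambda>(i,j). M $$ (s + i, s + j))"

definition levi_act :: "nat \<Rightarrow> nat \<Rightarrow> nat \<Rightarrow> complex mat \<Rightarrow> fun_V \<Rightarrow> fun_V" where
  "levi_act n p q M =
     derived_act n p q (diag_block p n M, - transpose_mat (diag_block 0 p M), diag_block (p + n) q M)"

lemma levi_act_diag_block_mat:
  assumes "Bp \<in> carrier_mat p p" "Bn \<in> carrier_mat n n" "Bq \<in> carrier_mat q q"
  shows "levi_act n p q (diag_block_mat [Bp, Bn, Bq]) =
    derived_act n p q (Bn, - transpose_mat Bp, Bq)"
proof -
  let ?M = "diag_block_mat [Bp, Bn, Bq]"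
  have "diag_block 0 p ?M = Bp" "diag_block p n ?M = Bn" "diag_block (p + n) q ?M = Bq"
    using assms by (auto intro!: eq_matI simp: diag_block_def Let_def)
  then show ?thesis by (simp add: levi_act_def)
qed

lemma cartan_subset_levi: "cartan (n + p + q) \<subseteq> levi n p q"
proof
  fix H assume H: "H \<in> cartan (n + p + q)"
  have "H = diag_block_mat [diag_block 0 p H, diag_block p n H, diag_block (p + n) q H]"
    (is "_ = ?M")
    using H
    by (intro eq_matI) (auto simp: cartan_def sl_def diagonal_mat_def diag_block_def Let_def)
  moreover have "tr ?M = 0"
    using H calculation by (simp add: cartan_def sl_def)
  moreover have "diag_block 0 p H \<in> carrier_mat p p" "diag_block p n H \<in> carrier_mat n n"
    "diag_block (p + n) q H \<in> carrier_mat q q"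
    by (auto simp: diag_block_def)
  ultimately show "H \<in> levi n p q"
    unfolding levi_def by blast
qed


section \<open>Weight spaces and characters\<close>

definition cscale :: "complex \<Rightarrow> ('a \<Rightarrow> complex) \<Rightarrow> 'a \<Rightarrow> complex" where
  "cscale c f = (\<lambda>v. c * f v)"

global_interpretation cfun: vector_space cscale
  by unfold_locales (auto simp: cscale_def plus_fun_def algebra_simps)

definition weight_space ::
  "nat \<Rightarrow> (complex mat \<Rightarrow> ('a \<Rightarrow> complex) \<Rightarrow> 'a \<Rightarrow> complex) \<Rightarrow> ('a \<Rightarrow> complex) set \<Rightarrow> weight \<Rightarrow> ('a \<Rightarrow> complex) set"
  where
  "weight_space N act L \<xi> = {f \<in> L. \<forall>H\<in>cartan N. act H f = cscale (\<xi> H) f}"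

text \<open>The hypothesis under which the character of \<open>L\<close> is defined: \<open>L\<close> is the direct sum of its
  weight spaces, and these are finite-dimensional.\<close>

definition has_character ::
  "nat \<Rightarrow> (complex mat \<Rightarrow> ('a \<Rightarrow> complex) \<Rightarrow> 'a \<Rightarrow> complex) \<Rightarrow> ('a \<Rightarrow> complex) set \<Rightarrow> bool" where
  "has_character N act L \<longleftrightarrow>
     cfun.subspace L \<and>
     (\<forall>\<xi>\<in>weights N. cfun.subspace (weight_space N act L \<xi>) \<and>
        (\<exists>B. finite B \<and> weight_space N act L \<xi> \<subseteq> cfun.span B)) \<and>
     (\<forall>f\<in>L. \<exists>!\<phi>. (\<forall>\<xi>\<in>weights N. \<phi> \<xi> \<in> weight_space N act L \<xi>) \<and>
        (\<forall>\<xi>. \<xi> \<notin> weights N \<longrightarrow> \<phi> \<xi> = 0) \<and>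
        finite {\<xi>. \<phi> \<xi> \<noteq> 0} \<and> f = (\<Sum>\<xi> | \<phi> \<xi> \<noteq> 0. \<phi> \<xi>))"

text \<open>A formal combination of the \<open>e\<^sup>\<xi>\<close> is represented by its coefficient function.\<close>

definition ch ::
  "nat \<Rightarrow> (complex mat \<Rightarrow> ('a \<Rightarrow> complex) \<Rightarrow> 'a \<Rightarrow> complex) \<Rightarrow> ('a \<Rightarrow> complex) set \<Rightarrow> weight \<Rightarrow> int" where
  "ch N act L = (\<lambda>\<xi>. if \<xi> \<in> weights N then int (cfun.dim (weight_space N act L \<xi>)) else 0)"


section \<open>Formal series\<close>

text \<open>The exponents of the monomials in the \<open>e\<^sup>-\<^sup>\<alpha>\<close>.\<close>

definition neg_cone :: "nat \<Rightarrow> weight set" where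
  "neg_cone N = {\<lambda>H. - (\<Sum>\<alpha>\<in>pos_roots N. of_nat (c \<alpha>) * \<alpha> H) | c :: weight \<Rightarrow> nat. True}"

definition fexp :: "weight \<Rightarrow> weight \<Rightarrow> int" where
  "fexp \<xi> = (\<lambda>\<mu>. if \<mu> = \<xi> then 1 else 0)"

definition series_ring :: "nat \<Rightarrow> (weight \<Rightarrow> int) ring" where
  "series_ring N =
     \<lparr>carrier = {F. \<forall>\<mu>. \<mu> \<notin> neg_cone N \<longrightarrow> F \<mu> = 0},
      monoid.mult = (\<lambda>F G \<mu>. \<Sum>(\<nu>,\<kappa>) | \<nu> \<in> neg_cone N \<and> \<kappa> \<in> neg_cone N \<and> \<nu> + \<kappa> = \<mu>. F \<nu> * G \<kappa>),
      one = fexp 0,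
      ring.zero = (\<lambda>_. 0),
      ring.add = (\<lambda>F G \<mu>. F \<mu> + G \<mu>)\<rparr>"

text \<open>The sums defining the product are finite, and \<open>series_ring N\<close> is a commutative ring: every
  positive root takes a positive integer value on the coweight \<open>rho_check N\<close>, which bounds the
  coefficients of a decomposition.\<close>

definition rho_check :: "nat \<Rightarrow> complex mat" where
  "rho_check N = Matrix.mat N N (\<lambda>(i,j). if i = j then of_int (int N - 1 - 2 * int i) else 0)"

lemma sum_rho: "(\<Sum>i<N. int N - 1 - 2 * int i) = 0"
proof -
  have "(\<Sum>i<N. c - 2 * int i) = int N * (c - int N + 1)" for c
    by (induction N) (auto simp: algebra_simps)
  then show ?thesis by simp
qed

lemma rho_check_in_cartan: "rho_check N \<in> cartan N"
proof -
  have "tr (rho_check N) = (\<Sum>i<N. of_int (int N - 1 - 2 * int i))"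
    unfolding tr_def rho_check_def by (intro sum.cong) auto
  also have "\<dots> = of_int (\<Sum>i<N. int N - 1 - 2 * int i)" by simp
  finally have "tr (rho_check N) = 0" by (simp only: sum_rho of_int_0)
  then show ?thesis
    by (auto simp: cartan_def sl_def rho_check_def diagonal_mat_def)
qed

lemma finite_pos_roots: "finite (pos_roots N)"
proof -
  have "pos_roots N \<subseteq> (\<lambda>(i,j). eps N i - eps N j) ` ({1..N} \<times> {1..N})"
    unfolding pos_roots_def by force
  then show ?thesis by (rule finite_subset) auto
qed

lemma pos_root_rho: "\<alpha> \<in> pos_roots N \<Longrightarrow> \<exists>h::nat. h \<ge> 1 \<and> \<alpha> (rho_check N) = of_nat h"
proof -
  assume "\<alpha> \<in> pos_roots N"
  then obtain i j where ij: "1 \<le> i" "i < j" "j \<le> N" "\<alpha> = eps N i - eps N j"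
    unfolding pos_roots_def by auto
  have "\<alpha> (rho_check N) = of_nat (2 * (j - i))"
    using ij rho_check_in_cartan[of N] by (simp add: eps_def rho_check_def of_nat_diff)
  then show ?thesis using ij by (intro exI[of _ "2 * (j - i)"]) auto
qed

lemma zero_in_neg_cone: "0 \<in> neg_cone N"
  unfolding neg_cone_def by (auto intro!: exI[of _ "\<lambda>_. 0"] simp: zero_fun_def)

lemma add_in_neg_cone: "\<mu> \<in> neg_cone N \<Longrightarrow> \<nu> \<in> neg_cone N \<Longrightarrow> \<mu> + \<nu> \<in> neg_cone N"
  unfolding neg_cone_def
  apply clarsimp
  subgoal for c d
    by (rule exI[of _ "\<lambda>\<alpha>. c \<alpha> + d \<alpha>"]) (auto simp: fun_eq_iff sum.distrib algebra_simps)
  done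

lemma neg_root_in_neg_cone:
  assumes "\<alpha> \<in> pos_roots N"
  shows "- \<alpha> \<in> neg_cone N"
proof -
  have "(\<Sum>\<beta>\<in>pos_roots N. of_nat (if \<beta> = \<alpha> then 1 else 0) * \<beta> H) = \<alpha> H" for H
  proof -
    have "(\<Sum>\<beta>\<in>pos_roots N. of_nat (if \<beta> = \<alpha> then 1 else 0) * \<beta> H) =
       (\<Sum>\<beta>\<in>pos_roots N. if \<beta> = \<alpha> then \<beta> H else 0)" by (intro sum.cong) auto
    then show ?thesis using assms finite_pos_roots[of N] by (simp add: sum.delta)
  qed
  then show ?thesis unfolding neg_cone_def
    by (auto intro!: exI[of _ "\<lambda>\<beta>. if \<beta> = \<alpha> then 1 else 0"])
qed

definition decomp :: "nat \<Rightarrow> weight \<Rightarrow> (weight \<times> weight) set" where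
  "decomp N \<mu> = {(\<nu>,\<kappa>). \<nu> \<in> neg_cone N \<and> \<kappa> \<in> neg_cone N \<and> \<nu> + \<kappa> = \<mu>}"

lemma cone_height:
  "\<exists>h::nat. (\<Sum>\<alpha>\<in>pos_roots N. of_nat (c \<alpha>) * \<alpha> (rho_check N)) = of_nat h \<and> (\<forall>\<alpha>\<in>pos_roots N. c \<alpha> \<le> h)"
proof -
  obtain r :: "weight \<Rightarrow> nat" where r: "\<And>\<alpha>. \<alpha> \<in> pos_roots N \<Longrightarrow> r \<alpha> \<ge> 1 \<and> \<alpha> (rho_check N) = of_nat (r \<alpha>)"
    using bchoice[of "pos_roots N" "\<lambda>\<alpha> h. h \<ge> 1 \<and> \<alpha> (rho_check N) = of_nat (h::nat)"] pos_root_rho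
    by blast
  have le: "c \<alpha> \<le> (\<Sum>\<alpha>\<in>pos_roots N. c \<alpha> * r \<alpha>)" if "\<alpha> \<in> pos_roots N" for \<alpha>
  proof -
    have "c \<alpha> \<le> c \<alpha> * r \<alpha>" using r[OF that] by simp
    also have "\<dots> \<le> (\<Sum>\<alpha>\<in>pos_roots N. c \<alpha> * r \<alpha>)"
      using that finite_pos_roots by (intro member_le_sum) auto
    finally show ?thesis .
  qed
  have "(\<Sum>\<alpha>\<in>pos_roots N. of_nat (c \<alpha>) * \<alpha> (rho_check N)) = of_nat (\<Sum>\<alpha>\<in>pos_roots N. c \<alpha> * r \<alpha>)"
    using r by (auto intro!: sum.cong)
  then show ?thesis using le by blast
qed

lemma finite_decomp: "finite (decomp N \<mu>)"
proof (cases "decomp N \<mu> = {}")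
  case False
  let ?wt = "\<lambda>c::weight \<Rightarrow> nat. (\<lambda>H. - (\<Sum>\<alpha>\<in>pos_roots N. of_nat (c \<alpha>) * \<alpha> H))"
  let ?B = "\<lambda>m. ?wt ` PiE (pos_roots N) (\<lambda>_. {0..m::nat})"
  define m where "m = nat \<lfloor>- Re (\<mu> (rho_check N))\<rfloor>"
  have key: "\<nu> \<in> ?B m" if nk: "\<nu> \<in> neg_cone N" "\<kappa> \<in> neg_cone N" "\<nu> + \<kappa> = \<mu>" for \<nu> \<kappa>
  proof -
    obtain c d where cd: "\<nu> = ?wt c" "\<kappa> = ?wt d" using nk unfolding neg_cone_def by auto
    obtain h where h: "(\<Sum>\<alpha>\<in>pos_roots N. of_nat (c \<alpha>) * \<alpha> (rho_check N)) = of_nat h" "\<forall>\<alpha>\<in>pos_roots N. c \<alpha> \<le> h"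
      using cone_height by blast
    obtain h' where h': "(\<Sum>\<alpha>\<in>pos_roots N. of_nat (d \<alpha>) * \<alpha> (rho_check N)) = of_nat h'"
      using cone_height by blast
    have "\<mu> (rho_check N) = - of_nat (h + h')"
      using nk(3) cd h h' by auto
    then have "m = h + h'" by (simp add: m_def)
    then have le: "c \<alpha> \<le> m" if "\<alpha> \<in> pos_roots N" for \<alpha> using h(2) that by force
    have "\<nu> = ?wt (restrict c (pos_roots N))" unfolding cd by auto
    moreover have "restrict c (pos_roots N) \<in> PiE (pos_roots N) (\<lambda>_. {0..m})" using le by auto
    ultimately show ?thesis by blast
  qed
  have "decomp N \<mu> \<subseteq> ?B m \<times> ?B m"
    unfolding decomp_def using key by (auto simp del: image_iff simp: add.commute)
  moreover have "finite (?B m)" by (intro finite_imageI finite_PiE finite_pos_roots) auto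
  ultimately show ?thesis using finite_subset by blast
qed auto

lemma mult_series_ring:
  "(F \<otimes>\<^bsub>series_ring N\<^esub> G) \<mu> = (\<Sum>(\<nu>,\<kappa>)\<in>decomp N \<mu>. F \<nu> * G \<kappa>)"
  by (simp add: series_ring_def decomp_def)

lemma decomp_D: "(a,b) \<in> decomp N \<mu> \<Longrightarrow> a \<in> neg_cone N \<and> b \<in> neg_cone N \<and> a + b = \<mu>"
  by (simp add: decomp_def)

lemma assoc_series_ring:
  "((F \<otimes>\<^bsub>series_ring N\<^esub> G) \<otimes>\<^bsub>series_ring N\<^esub> K) = (F \<otimes>\<^bsub>series_ring N\<^esub> (G \<otimes>\<^bsub>series_ring N\<^esub> K))"
proof
  fix \<mu>
  have "((F \<otimes>\<^bsub>series_ring N\<^esub> G) \<otimes>\<^bsub>series_ring N\<^esub> K) \<mu> =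
     (\<Sum>ab\<in>decomp N \<mu>. \<Sum>xy\<in>decomp N (fst ab). F (fst xy) * G (snd xy) * K (snd ab))"
    by (simp add: mult_series_ring case_prod_unfold sum_distrib_right)
  also have "\<dots> = (\<Sum>((a,b),(x,y))\<in>(SIGMA ab:decomp N \<mu>. decomp N (fst ab)). F x * G y * K b)"
    by (subst sum.Sigma) (auto simp: finite_decomp case_prod_unfold)
  also have "\<dots> = (\<Sum>((a,b),(x,y))\<in>(SIGMA ab:decomp N \<mu>. decomp N (snd ab)). F a * G x * K y)"
    by (rule sum.reindex_bij_witness[of _ "\<lambda>((a,b),(x,y)). ((a + x, y),(a,x))" "\<lambda>((a,b),(x,y)). ((x, y + b),(y,b))"])
      (auto simp: decomp_def add_in_neg_cone add.assoc)
  also have "\<dots> = (\<Sum>ab\<in>decomp N \<mu>. \<Sum>xy\<in>decomp N (snd ab). F (fst ab) * (G (fst xy) * K (snd xy)))"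
    by (subst sum.Sigma) (auto simp: finite_decomp case_prod_unfold mult.assoc)
  also have "\<dots> = (F \<otimes>\<^bsub>series_ring N\<^esub> (G \<otimes>\<^bsub>series_ring N\<^esub> K)) \<mu>"
    by (simp add: mult_series_ring case_prod_unfold sum_distrib_left)
  finally show "((F \<otimes>\<^bsub>series_ring N\<^esub> G) \<otimes>\<^bsub>series_ring N\<^esub> K) \<mu> = (F \<otimes>\<^bsub>series_ring N\<^esub> (G \<otimes>\<^bsub>series_ring N\<^esub> K)) \<mu>" .
qed

lemma comm_series_ring: "F \<otimes>\<^bsub>series_ring N\<^esub> G = G \<otimes>\<^bsub>series_ring N\<^esub> F"
proof
  fix \<mu>
  show "(F \<otimes>\<^bsub>series_ring N\<^esub> G) \<mu> = (G \<otimes>\<^bsub>series_ring N\<^esub> F) \<mu>"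
    unfolding mult_series_ring
    by (rule sum.reindex_bij_witness[of _ prod.swap prod.swap]) (auto simp: decomp_def add.commute)
qed

lemma mult_closed_series_ring: "F \<otimes>\<^bsub>series_ring N\<^esub> G \<in> carrier (series_ring N)"
proof -
  have "(F \<otimes>\<^bsub>series_ring N\<^esub> G) \<mu> = 0" if "\<mu> \<notin> neg_cone N" for \<mu>
  proof -
    have "decomp N \<mu> = {}" using that add_in_neg_cone by (auto simp: decomp_def)
    then show ?thesis by (simp add: mult_series_ring)
  qed
  then show ?thesis by (simp add: series_ring_def)
qed

lemma one_mult_series_ring:
  assumes "F \<in> carrier (series_ring N)"
  shows "\<one>\<^bsub>series_ring N\<^esub> \<otimes>\<^bsub>series_ring N\<^esub> F = F"
proof
  fix \<mu>
  show "(\<one>\<^bsub>series_ring N\<^esub> \<otimes>\<^bsub>series_ring N\<^esub> F) \<mu> = F \<mu>"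
  proof (cases "\<mu> \<in> neg_cone N")
    case True
    have "(\<one>\<^bsub>series_ring N\<^esub> \<otimes>\<^bsub>series_ring N\<^esub> F) \<mu> = (\<Sum>x\<in>{(0,\<mu>)}. fexp 0 (fst x) * F (snd x))"
      unfolding mult_series_ring case_prod_unfold using True zero_in_neg_cone
      by (intro sum.mono_neutral_cong_right finite_decomp) (auto simp: decomp_def fexp_def series_ring_def)
    then show ?thesis by (simp add: fexp_def)
  next
    case False
    then show ?thesis
      using mult_closed_series_ring[of N "\<one>\<^bsub>series_ring N\<^esub>" F] assms by (auto simp: series_ring_def)
  qed
qed

lemma cring_series_ring: "cring (series_ring N)"
proof (rule cringI)
  show "abelian_group (series_ring N)"
  proof (rule abelian_groupI)
    fix F assume "F \<in> carrier (series_ring N)"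
    then show "\<exists>G\<in>carrier (series_ring N). G \<oplus>\<^bsub>series_ring N\<^esub> F = \<zero>\<^bsub>series_ring N\<^esub>"
      by (intro bexI[of _ "\<lambda>\<mu>. - F \<mu>"]) (auto simp: series_ring_def)
  qed (auto simp: series_ring_def)
  show "Group.comm_monoid (series_ring N)"
  proof (rule comm_monoidI)
    show "\<one>\<^bsub>series_ring N\<^esub> \<in> carrier (series_ring N)"
      using zero_in_neg_cone by (auto simp: series_ring_def fexp_def)
  qed (use one_mult_series_ring assoc_series_ring comm_series_ring mult_closed_series_ring in auto)
  fix F G H
  show "(F \<oplus>\<^bsub>series_ring N\<^esub> G) \<otimes>\<^bsub>series_ring N\<^esub> H =
      F \<otimes>\<^bsub>series_ring N\<^esub> H \<oplus>\<^bsub>series_ring N\<^esub> G \<otimes>\<^bsub>series_ring N\<^esub> H"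
    by (auto simp: fun_eq_iff series_ring_def case_prod_unfold distrib_right sum.distrib)
qed

definition Delta :: "nat \<Rightarrow> nat \<Rightarrow> nat \<Rightarrow> weight \<Rightarrow> int" where
  "Delta n p q =
     finprod (series_ring (n + p + q))
       (\<lambda>\<alpha>. \<one>\<^bsub>series_ring (n + p + q)\<^esub> \<ominus>\<^bsub>series_ring (n + p + q)\<^esub> fexp (- \<alpha>))
       (noncompact_pos_roots n p q)"

end

theory Submission
  imports Defs
begin

text \<open>
  Both sides of the identity count the same thing. The noncompact positive roots are attached
  bijectively to the matrix positions of \<open>\<uu>'\<^sup>+\<close>, collected in \<open>nc_index\<close>, and the coordinate function
  on \<open>V\<close> belonging to the position of a root \<open>\<alpha>\<close> is a weight vector of weight \<open>- \<alpha>\<close>: the inverse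
  transposes in the action on \<open>V\<close> and in the embedding of \<open>\<gg>\<ll>\<^sub>p\<close> are what makes every sign come out
  negative.

  On the side of the coordinate ring, a monomial with exponents \<open>c\<close> therefore has weight
  \<open>- (\<Sum>\<alpha>. c(\<alpha>) \<alpha>)\<close>. The monomials span the ring, and they are linearly independent because they are
  distinct multiplicative functions (Dedekind's argument, \<open>independent_multiplicative\<close>). So a weight
  space has as its basis the monomials of that weight, and the coefficient of \<open>e\<^sup>\<xi>\<close> in the character
  is the number of exponent functions \<open>c\<close> with \<open>- (\<Sum>\<alpha>. c(\<alpha>) \<alpha>) = \<xi>\<close>. The passage from a basis of weight
  vectors to a character is general linear algebra, carried out in the locale \<open>weight_basis\<close>. The
  number is finite because positive roots are positive on \<open>rho_check\<close>, which bounds all exponents.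

  On the side of the product, the same numbers are the coefficients of the inverse: expanding each
  \<open>(1 - e\<^sup>-\<^sup>\<alpha>)\<^sup>-\<^sup>1\<close> as a geometric series gives the partition series. Instead of multiplying infinite
  series, the proof removes one root at a time: sorting the exponent functions by whether
  \<open>c(\<alpha>)\<close> vanishes shows that multiplication by \<open>1 - e\<^sup>-\<^sup>\<alpha>\<close> turns the partition series of
  \<open>S \<union> {\<alpha>}\<close> into that of \<open>S\<close>, and that of the empty set is \<open>1\<close>.
\<close>

section \<open>The noncompact positive roots\<close>

text \<open>Positions are counted from 0, as matrix entries are, while \<open>eps\<close> counts from 1.\<close>

definition root_at :: "nat \<Rightarrow> nat \<times> nat \<Rightarrow> weight" where
  "root_at N x = eps N (Suc (fst x)) - eps N (Suc (snd x))"

lemma root_at_apply: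
  "root_at N (i, j) H = (if H \<in> cartan N then H $$ (i, i) - H $$ (j, j) else 0)"
  by (simp add: root_at_def eps_def)

lemma pos_roots_eq: "pos_roots N = {root_at N (i, j) | i j. i < j \<and> j < N}"
proof (intro equalityI subsetI)
  fix \<alpha> assume "\<alpha> \<in> pos_roots N"
  then obtain i j where ij: "1 \<le> i" "i < j" "j \<le> N" "\<alpha> = eps N i - eps N j"
    unfolding pos_roots_def by auto
  then have "\<alpha> = root_at N (i - 1, j - 1)" "i - 1 < j - 1" "j - 1 < N"
    by (auto simp: root_at_def)
  then show "\<alpha> \<in> {root_at N (i, j) | i j. i < j \<and> j < N}" by blast
next
  fix \<alpha> assume "\<alpha> \<in> {root_at N (i, j) | i j. i < j \<and> j < N}"
  then obtain i j where ij: "i < j" "j < N" "\<alpha> = root_at N (i, j)" by auto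
  then have "\<alpha> = eps N (Suc i) - eps N (Suc j)" by (simp add: root_at_def)
  moreover have "1 \<le> Suc i" "Suc i < Suc j" "Suc j \<le> N" using ij by auto
  ultimately show "\<alpha> \<in> pos_roots N" unfolding pos_roots_def by blast
qed

text \<open>The coroot tests whether two roots agree: on it, its own root takes the value 2, and any
  other difference of two diagonal entries is smaller. This determines roots although the
  \<open>eps N i\<close> are linearly dependent on traceless matrices.\<close>

definition coroot :: "nat \<Rightarrow> nat \<times> nat \<Rightarrow> complex mat" where
  "coroot N x = mat_diag N (\<lambda>a. if a = fst x then 1 else if a = snd x then - 1 else 0)"

lemma mat_diag_in_cartan: "(\<Sum>i<N. f i) = 0 \<Longrightarrow> mat_diag N f \<in> cartan N"
  by (auto simp: cartan_def sl_def tr_def mat_diag_def diagonal_mat_def)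

lemma coroot_in_cartan:
  assumes "i < N" "j < N" "i \<noteq> j"
  shows "coroot N (i, j) \<in> cartan N"
proof -
  have "(\<Sum>a<N. if a = i then 1 else if a = j then - 1 else (0::complex)) =
    (\<Sum>a<N. (if a = i then 1 else 0) + (if a = j then - 1 else 0))"
    using assms by (intro sum.cong) auto
  also have "\<dots> = 0" using assms by (simp add: sum.distrib)
  finally show ?thesis unfolding coroot_def by (intro mat_diag_in_cartan) (simp only: fst_conv snd_conv)
qed

lemma coroot_separates:
  assumes "i < N" "j < N" "i \<noteq> j" "a < N" "b < N" "a \<noteq> b"
    and "coroot N (i, j) $$ (a, a) - coroot N (i, j) $$ (b, b) = 2"
  shows "a = i \<and> b = j"
  using assms by (auto simp: coroot_def mat_diag_def split: if_splits)

lemma root_at_coroot: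
  assumes "i < N" "j < N" "i \<noteq> j"
  shows "root_at N (i, j) (coroot N (i, j)) = 2"
  using assms coroot_in_cartan[OF assms]
  by (simp add: root_at_apply) (simp add: coroot_def mat_diag_def)

lemma inj_on_root_at: "inj_on (root_at N) {(i, j). i < N \<and> j < N \<and> i \<noteq> j}"
proof (rule inj_onI, clarify)
  fix a b i j
  assume *: "a < N" "b < N" "a \<noteq> b" "i < N" "j < N" "i \<noteq> j" "root_at N (a, b) = root_at N (i, j)"
  have "root_at N (a, b) (coroot N (i, j)) = 2" using root_at_coroot * by simp
  then have "coroot N (i, j) $$ (a, a) - coroot N (i, j) $$ (b, b) = 2"
    using *(4-6) coroot_in_cartan[of i N j] unfolding root_at_apply by simp
  then show "a = i \<and> b = j" using * by (intro coroot_separates) auto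
qed

definition nc_index :: "nat \<Rightarrow> nat \<Rightarrow> nat \<Rightarrow> (nat \<times> nat) set" where
  "nc_index n p q = {..<p} \<times> {p..<p+n} \<union> {p..<p+n} \<times> {p+n..<p+n+q}"

lemma finite_nc_index: "finite (nc_index n p q)"
  by (simp add: nc_index_def)

lemma mat_unit_in_root_space:
  assumes "i < N" "j < N" "i \<noteq> j"
  shows "Matrix.mat N N (\<lambda>x. if x = (i, j) then 1 else 0) \<in> root_space N (root_at N (i, j))"
    (is "?E \<in> _")
proof -
  have "H * ?E - ?E * H = root_at N (i, j) H \<cdot>\<^sub>m ?E" if H: "H \<in> cartan N" for H
  proof -
    have dm: "H = mat_diag N (\<lambda>a. H $$ (a, a))" "H \<in> carrier_mat N N"
      using H by (auto simp: cartan_def sl_def diagonal_mat_def mat_diag_def)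
    have E: "?E \<in> carrier_mat N N" by simp
    \<comment> \<open>Only the two factors \<open>H\<close> are to be expanded, not the one inside the weight.\<close>
    show ?thesis
      using H dm(2) by (subst dm(1), subst (2) dm(1), subst mat_diag_mult_left[OF E], subst mat_diag_mult_right[OF E])
        (intro eq_matI, auto simp: root_at_apply)
  qed
  moreover have "?E \<in> sl N" using assms by (auto simp: sl_def tr_def intro!: sum.neutral)
  ultimately show ?thesis by (simp add: root_space_def)
qed

text \<open>Comparing entries of \<open>[H, X] = \<alpha>(H) X\<close> for a single \<open>H\<close>, the coroot, suffices.\<close>

lemma root_space_entry_zero:
  assumes X: "X \<in> root_space N (root_at N (i, j))"
    and "i < N" "j < N" "i \<noteq> j" "a < N" "b < N" "a \<noteq> b" "(a, b) \<noteq> (i, j)"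
  shows "X $$ (a, b) = 0"
proof (rule ccontr)
  assume nz: "X $$ (a, b) \<noteq> 0"
  let ?H = "coroot N (i, j)"
  have H: "?H \<in> cartan N" using assms by (intro coroot_in_cartan)
  have XN: "X \<in> carrier_mat N N" using X by (simp add: root_space_def sl_def)
  have "?H * X - X * ?H = root_at N (i, j) ?H \<cdot>\<^sub>m X" using X H by (simp add: root_space_def)
  then have "?H * X - X * ?H = 2 \<cdot>\<^sub>m X" using root_at_coroot assms by simp
  then have "(?H * X - X * ?H) $$ (a, b) = 2 * X $$ (a, b)" using XN assms by simp
  then have "(?H $$ (a, a) - ?H $$ (b, b)) * X $$ (a, b) = 2 * X $$ (a, b)"
    using XN assms unfolding coroot_def
    by (simp add: mat_diag_mult_left[OF XN] mat_diag_mult_right[OF XN] algebra_simps)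
      (simp add: mat_diag_def algebra_simps)
  then have "?H $$ (a, a) - ?H $$ (b, b) = 2" using nz by simp
  then show False using coroot_separates[of i N j a b] assms by blast
qed

text \<open>If exactly one of \<open>i\<close> and \<open>j\<close> lies in the middle index block, the matrix unit at \<open>(i, j)\<close>
  witnesses that the root is noncompact. Otherwise the root space lies in \<open>\<kk>'\<close>, because the only
  entry of a root vector off the diagonal that can be nonzero is the one at \<open>(i, j)\<close>.\<close>

lemma noncompact_pos_roots_eq: "noncompact_pos_roots n p q = root_at (n + p + q) ` nc_index n p q"
proof -
  let ?N = "n + p + q"
  have "root_space ?N (root_at ?N (i, j)) \<subseteq> compact_subalgebra n p q \<longleftrightarrow>
      (i \<in> {p..<p+n}) = (j \<in> {p..<p+n})" if ij: "i < j" "j < ?N" for i j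
  proof
    assume sub: "root_space ?N (root_at ?N (i, j)) \<subseteq> compact_subalgebra n p q"
    let ?E = "Matrix.mat ?N ?N (\<lambda>x. if x = (i, j) then 1 else 0) :: complex mat"
    have i: "i < ?N" "i \<noteq> j" using ij by simp_all
    have E: "?E \<in> compact_subalgebra n p q"
      by (rule subsetD[OF sub mat_unit_in_root_space[OF i(1) ij(2) i(2)]])
    have "?E $$ (i, j) = 1" using i(1) ij(2) by simp
    then have "?E $$ (i, j) \<noteq> 0" by simp
    then show "(i \<in> {p..<p+n}) = (j \<in> {p..<p+n})"
      using E i(1) ij(2) unfolding compact_subalgebra_def by blast
  next
    assume eq: "(i \<in> {p..<p+n}) = (j \<in> {p..<p+n})"
    show "root_space ?N (root_at ?N (i, j)) \<subseteq> compact_subalgebra n p q"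
    proof
      fix X assume X: "X \<in> root_space ?N (root_at ?N (i, j))"
      have "X $$ (a, b) = 0"
        if "a < ?N" "b < ?N" "(a \<in> {p..<p+n}) \<noteq> (b \<in> {p..<p+n})" for a b
      proof (rule root_space_entry_zero[OF X])
        show "a \<noteq> b" "(a, b) \<noteq> (i, j)" using that(3) eq by auto
      qed (use that ij in auto)
      then show "X \<in> compact_subalgebra n p q"
        using X by (simp add: compact_subalgebra_def root_space_def)
    qed
  qed
  then have "noncompact_pos_roots n p q =
      {root_at ?N (i, j) | i j. i < j \<and> j < ?N \<and> (i \<in> {p..<p+n}) \<noteq> (j \<in> {p..<p+n})}"
    unfolding noncompact_pos_roots_def pos_roots_eq by auto
  also have "\<dots> = root_at ?N ` {(i, j). i < j \<and> j < ?N \<and> (i \<in> {p..<p+n}) \<noteq> (j \<in> {p..<p+n})}"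
    by auto
  also have "{(i, j). i < j \<and> j < ?N \<and> (i \<in> {p..<p+n}) \<noteq> (j \<in> {p..<p+n})} = nc_index n p q"
    by (auto simp: nc_index_def)
  finally show ?thesis .
qed

lemma root_at_nc_index_eq:
  "root_at N ` nc_index n p q =
     {eps N i - eps N (p + k) | i k. 1 \<le> i \<and> i \<le> p \<and> 1 \<le> k \<and> k \<le> n} \<union>
     {eps N (p + k) - eps N (p + n + j) | k j. 1 \<le> k \<and> k \<le> n \<and> 1 \<le> j \<and> j \<le> q}"
    (is "_ = ?A \<union> ?B")
proof (intro equalityI subsetI)
  fix \<alpha> assume "\<alpha> \<in> root_at N ` nc_index n p q"
  then obtain i j where ij: "(i, j) \<in> nc_index n p q" "\<alpha> = root_at N (i, j)" by auto
  then consider "i < p" "p \<le> j" "j < p + n" | "p \<le> i" "i < p + n" "p + n \<le> j" "j < p + n + q"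
    by (auto simp: nc_index_def)
  then show "\<alpha> \<in> ?A \<union> ?B"
  proof cases
    case 1
    then have "\<alpha> = eps N (Suc i) - eps N (p + Suc (j - p))" "1 \<le> Suc i \<and> Suc i \<le> p \<and> 1 \<le> Suc (j - p) \<and> Suc (j - p) \<le> n"
      using ij by (auto simp: root_at_def)
    then show ?thesis by blast
  next
    case 2
    then have "\<alpha> = eps N (p + Suc (i - p)) - eps N (p + n + Suc (j - (p + n)))"
      "1 \<le> Suc (i - p) \<and> Suc (i - p) \<le> n \<and> 1 \<le> Suc (j - (p + n)) \<and> Suc (j - (p + n)) \<le> q"
      using ij by (auto simp: root_at_def)
    then show ?thesis by blast
  qed
next
  fix \<alpha> assume "\<alpha> \<in> ?A \<union> ?B"
  then consider i k where "1 \<le> i" "i \<le> p" "1 \<le> k" "k \<le> n" "\<alpha> = eps N i - eps N (p + k)"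
    | k j where "1 \<le> k" "k \<le> n" "1 \<le> j" "j \<le> q" "\<alpha> = eps N (p + k) - eps N (p + n + j)"
    by blast
  then show "\<alpha> \<in> root_at N ` nc_index n p q"
  proof cases
    case 1
    then have "\<alpha> = root_at N (i - 1, p + k - 1)" by (simp add: root_at_def)
    moreover have "(i - 1, p + k - 1) \<in> nc_index n p q" using 1 by (auto simp: nc_index_def)
    ultimately show ?thesis by blast
  next
    case 2
    then have "\<alpha> = root_at N (p + k - 1, p + n + j - 1)" by (simp add: root_at_def)
    moreover have "(p + k - 1, p + n + j - 1) \<in> nc_index n p q" using 2 by (auto simp: nc_index_def)
    ultimately show ?thesis by blast
  qed
qed

lemma nc_index_less: "x \<in> nc_index n p q \<Longrightarrow> fst x < snd x \<and> snd x < n + p + q"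
  by (auto simp: nc_index_def)

section \<open>Partition series\<close>

text \<open>Exponent functions vanish off \<open>S\<close>, so that each multiset of elements of \<open>S\<close> is represented
  exactly once.\<close>

definition exponents :: "'i set \<Rightarrow> ('i \<Rightarrow> nat) set" where
  "exponents S = {c. \<forall>x. x \<notin> S \<longrightarrow> c x = 0}"

definition neg_sum :: "('i \<Rightarrow> weight) \<Rightarrow> 'i set \<Rightarrow> ('i \<Rightarrow> nat) \<Rightarrow> weight" where
  "neg_sum r S c = (\<lambda>H. - (\<Sum>x\<in>S. of_nat (c x) * r x H))"

definition partitions :: "('i \<Rightarrow> weight) \<Rightarrow> 'i set \<Rightarrow> weight \<Rightarrow> ('i \<Rightarrow> nat) set" where
  "partitions r S \<mu> = {c \<in> exponents S. neg_sum r S c = \<mu>}"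

text \<open>This is Kostant's partition function of the family \<open>r\<close>, reflected to the negative cone.\<close>

definition partition_series :: "('i \<Rightarrow> weight) \<Rightarrow> 'i set \<Rightarrow> weight \<Rightarrow> int" where
  "partition_series r S = (\<lambda>\<mu>. int (card (partitions r S \<mu>)))"

text \<open>Evaluation at \<open>rho_check N\<close> turns the equation for the exponents into an equation of
  natural numbers in which every exponent has a positive coefficient.\<close>

lemma finite_partitions:
  fixes r :: "'i \<Rightarrow> weight"
  assumes "finite S" and r: "r ` S \<subseteq> pos_roots N"
  shows "finite (partitions r S \<mu>)"
proof -
  obtain h :: "'i \<Rightarrow> nat" where h: "\<And>x. x \<in> S \<Longrightarrow> h x \<ge> 1 \<and> r x (rho_check N) = of_nat (h x)"
    using bchoice[of S "\<lambda>x h. h \<ge> 1 \<and> r x (rho_check N) = of_nat (h::nat)"] r pos_root_rho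
    by blast
  \<comment> \<open>The height of \<open>- \<mu>\<close>, when it is a natural number, bounds every exponent.\<close>
  define m where "m = nat \<lfloor>- Re (\<mu> (rho_check N))\<rfloor>"
  have "partitions r S \<mu> \<subseteq> {c. (\<forall>x. x \<in> S \<longrightarrow> c x \<in> {0..m}) \<and> (\<forall>x. x \<notin> S \<longrightarrow> c x = 0)}"
  proof
    fix c assume c: "c \<in> partitions r S \<mu>"
    have "(\<Sum>x\<in>S. of_nat (c x) * r x (rho_check N)) = of_nat (\<Sum>x\<in>S. c x * h x)"
      using h by (auto intro!: sum.cong)
    moreover have "neg_sum r S c (rho_check N) = \<mu> (rho_check N)"
      using c by (simp add: partitions_def)
    ultimately have "\<mu> (rho_check N) = - of_nat (\<Sum>x\<in>S. c x * h x)"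
      by (simp add: neg_sum_def)
    then have m: "m = (\<Sum>x\<in>S. c x * h x)"
      unfolding m_def by (simp del: of_nat_sum)
    have "c x \<le> m" if "x \<in> S" for x
    proof -
      have "c x \<le> c x * h x" using h[OF that] by simp
      also have "\<dots> \<le> m" unfolding m using that assms(1) by (intro member_le_sum) auto
      finally show ?thesis .
    qed
    then show "c \<in> {c. (\<forall>x. x \<in> S \<longrightarrow> c x \<in> {0..m}) \<and> (\<forall>x. x \<notin> S \<longrightarrow> c x = 0)}"
      using c by (auto simp: partitions_def exponents_def)
  qed
  moreover have "finite {c. (\<forall>x. x \<in> S \<longrightarrow> c x \<in> {0..m}) \<and> (\<forall>x. x \<notin> S \<longrightarrow> c x = 0)}"
    using finite_set_of_finite_funs[OF assms(1), of "{0..m}" "0::nat"] by (simp add: all_conj_distrib)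
  ultimately show ?thesis by (rule finite_subset)
qed

lemma neg_sum_in_neg_cone:
  assumes "finite S" and r: "r ` S \<subseteq> pos_roots N"
  shows "neg_sum r S c \<in> neg_cone N"
proof -
  have scaled: "(\<lambda>H. of_nat k * - r x H) \<in> neg_cone N" if "x \<in> S" for x and k :: nat
  proof (induction k)
    case 0
    then show ?case using zero_in_neg_cone[of N] by (simp add: zero_fun_def)
  next
    case (Suc k)
    have "- r x \<in> neg_cone N" using that r by (intro neg_root_in_neg_cone) auto
    then have "(\<lambda>H. - r x H) \<in> neg_cone N" by (simp add: fun_Compl_def)
    from add_in_neg_cone[OF this Suc] show ?case by (simp add: plus_fun_def distrib_right)
  qed
  have "(\<lambda>H. \<Sum>x\<in>T. of_nat (c x) * (- r x H)) \<in> neg_cone N" if "T \<subseteq> S" for T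
    using finite_subset[OF that assms(1)] that
  proof (induction T rule: finite_induct)
    case empty
    then show ?case using zero_in_neg_cone by (simp add: zero_fun_def)
  next
    case (insert x T)
    then show ?case using add_in_neg_cone[OF scaled[of x], of "\<lambda>H. \<Sum>x\<in>T. of_nat (c x) * (- r x H)"]
      by (simp add: plus_fun_def)
  qed
  from this[of S] show ?thesis by (simp add: neg_sum_def sum_negf)
qed

lemma partition_series_closed:
  assumes "finite S" "r ` S \<subseteq> pos_roots N"
  shows "partition_series r S \<in> carrier (series_ring N)"
proof -
  have "partitions r S \<mu> = {}" if "\<mu> \<notin> neg_cone N" for \<mu>
    using neg_sum_in_neg_cone[OF assms] that by (auto simp: partitions_def)
  then show ?thesis by (auto simp: series_ring_def partition_series_def)
qed

lemma fexp_closed: "\<nu> \<in> neg_cone N \<Longrightarrow> fexp \<nu> \<in> carrier (series_ring N)"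
  by (auto simp: series_ring_def fexp_def)

lemma fexp_mult:
  assumes "\<nu> \<in> neg_cone N" "F \<in> carrier (series_ring N)"
  shows "(fexp \<nu> \<otimes>\<^bsub>series_ring N\<^esub> F) \<mu> = F (\<mu> - \<nu>)"
proof (cases "\<mu> - \<nu> \<in> neg_cone N")
  case True
  have "(fexp \<nu> \<otimes>\<^bsub>series_ring N\<^esub> F) \<mu> = (\<Sum>x\<in>{(\<nu>, \<mu> - \<nu>)}. fexp \<nu> (fst x) * F (snd x))"
    unfolding mult_series_ring case_prod_unfold using True assms
    by (intro sum.mono_neutral_cong_right finite_decomp) (auto simp: decomp_def fexp_def)
  then show ?thesis by (simp add: fexp_def)
next
  case False
  have "fexp \<nu> (fst x) * F (snd x) = 0" if "x \<in> decomp N \<mu>" for x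
    using that False by (cases x) (auto simp: decomp_def fexp_def)
  then have "(fexp \<nu> \<otimes>\<^bsub>series_ring N\<^esub> F) \<mu> = 0"
    unfolding mult_series_ring case_prod_unfold by (intro sum.neutral ballI)
  then show ?thesis using False assms by (simp add: series_ring_def)
qed

lemma neg_sum_insert:
  assumes "finite S" "x \<notin> S"
  shows "neg_sum r (insert x S) c = (\<lambda>H. - (of_nat (c x) * r x H)) + neg_sum r S c"
  using assms by (auto simp: neg_sum_def)

lemma neg_sum_cong: "(\<And>x. x \<in> S \<Longrightarrow> c x = d x) \<Longrightarrow> neg_sum r S c = neg_sum r S d"
  by (simp add: neg_sum_def)

text \<open>Partitions without the part \<open>x\<close> are partitions over \<open>S\<close>; from any other, one copy of the part
  \<open>x\<close> can be taken away, which raises the weight by \<open>r x\<close>.\<close>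

lemma card_partitions_insert:
  assumes "finite S" "x \<notin> S" "r ` insert x S \<subseteq> pos_roots N"
  shows "card (partitions r (insert x S) \<mu>) =
    card (partitions r S \<mu>) + card (partitions r (insert x S) (\<mu> + r x))"
proof -
  let ?P = "partitions r (insert x S)"
  have fin: "finite (?P \<mu>)" for \<mu> using assms by (intro finite_partitions) auto
  have "?P \<mu> = {c \<in> ?P \<mu>. c x = 0} \<union> {c \<in> ?P \<mu>. c x > 0}" by auto
  then have "card (?P \<mu>) = card {c \<in> ?P \<mu>. c x = 0} + card {c \<in> ?P \<mu>. c x > 0}"
    using fin[of \<mu>] by (subst card_Un_disjoint[symmetric]) auto
  moreover have "{c \<in> ?P \<mu>. c x = 0} = partitions r S \<mu>"
  proof -
    have zero: "c x = 0" if "c \<in> exponents S" for c using that assms(2) by (simp add: exponents_def)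
    have ins: "c \<in> exponents (insert x S) \<and> c x = 0 \<longleftrightarrow> c \<in> exponents S" for c
    proof -
      have "c y = 0" if "\<forall>y. y \<noteq> x \<and> y \<notin> S \<longrightarrow> c y = 0" "c x = 0" "y \<notin> S" for y
        using that by (cases "y = x") auto
      then show ?thesis using assms(2) by (auto simp: exponents_def)
    qed
    have sm: "neg_sum r (insert x S) c = neg_sum r S c" if "c x = 0" for c
      using assms(1,2) that by (simp add: neg_sum_def)
    show ?thesis
      unfolding partitions_def using zero ins sm by auto
  qed
  moreover have "bij_betw (\<lambda>c. c(x := c x - 1)) {c \<in> ?P \<mu>. c x > 0} (?P (\<mu> + r x))"
  proof (rule bij_betw_byWitness[where f' = "\<lambda>c. c(x := Suc (c x))"])
    have upd: "neg_sum r S (c(x := k)) = neg_sum r S c" for c k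
      using assms(2) by (intro neg_sum_cong) auto
    have shift: "neg_sum r (insert x S) (c(x := Suc (c x))) + r x = neg_sum r (insert x S) c" for c
      using assms(1,2) by (simp add: neg_sum_insert upd fun_eq_iff algebra_simps)
    have expo: "c(x := k) \<in> exponents (insert x S)" if "c \<in> exponents (insert x S)" for c k
      using that by (auto simp: exponents_def)
    show "(\<lambda>c. c(x := c x - 1)) ` {c \<in> ?P \<mu>. c x > 0} \<subseteq> ?P (\<mu> + r x)"
    proof clarify
      fix c assume c: "c \<in> ?P \<mu>" "c x > 0"
      then have "neg_sum r (insert x S) (c(x := c x - 1)) = \<mu> + r x"
        using shift[of "c(x := c x - 1)"] by (simp add: partitions_def)
      then show "c(x := c x - 1) \<in> ?P (\<mu> + r x)" using c expo by (simp add: partitions_def)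
    qed
    show "(\<lambda>c. c(x := Suc (c x))) ` ?P (\<mu> + r x) \<subseteq> {c \<in> ?P \<mu>. c x > 0}"
    proof clarify
      fix c assume c: "c \<in> ?P (\<mu> + r x)"
      have "neg_sum r (insert x S) (c(x := Suc (c x))) + r x = \<mu> + r x"
        using c shift[of c] by (simp add: partitions_def)
      then show "c(x := Suc (c x)) \<in> ?P \<mu> \<and> 0 < (c(x := Suc (c x))) x"
        using c expo by (simp add: partitions_def)
    qed
  qed auto
  ultimately show ?thesis by (simp add: bij_betw_same_card)
qed

lemma one_minus_exp_mult_partition_series:
  assumes "finite S" "x \<notin> S" "r ` insert x S \<subseteq> pos_roots N"
  shows "(\<one>\<^bsub>series_ring N\<^esub> \<ominus>\<^bsub>series_ring N\<^esub> fexp (- r x)) \<otimes>\<^bsub>series_ring N\<^esub> partition_series r (insert x S) =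
    partition_series r S"
proof -
  interpret R: cring "series_ring N" by (rule cring_series_ring)
  have cone: "- r x \<in> neg_cone N" using assms(3) by (intro neg_root_in_neg_cone) auto
  note cl = fexp_closed[OF cone] partition_series_closed[of "insert x S" r N] partition_series_closed[of S r N]
  have cl2: "partition_series r (insert x S) \<in> carrier (series_ring N)"
    "partition_series r S \<in> carrier (series_ring N)" using cl assms by auto
  have "partition_series r (insert x S) =
      partition_series r S \<oplus>\<^bsub>series_ring N\<^esub> (fexp (- r x) \<otimes>\<^bsub>series_ring N\<^esub> partition_series r (insert x S))"
    (is "?P = ?Q \<oplus>\<^bsub>_\<^esub> ?E")
  proof
    fix \<mu>
    have "?E \<mu> = ?P (\<mu> + r x)" using fexp_mult[OF cone cl2(1)] by simp
    then show "?P \<mu> = (?Q \<oplus>\<^bsub>series_ring N\<^esub> ?E) \<mu>"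
      using card_partitions_insert[OF assms, of \<mu>] by (simp add: series_ring_def partition_series_def)
  qed
  moreover have "(\<one>\<^bsub>series_ring N\<^esub> \<ominus>\<^bsub>series_ring N\<^esub> fexp (- r x)) \<otimes>\<^bsub>series_ring N\<^esub> ?P = ?P \<ominus>\<^bsub>series_ring N\<^esub> ?E"
    using cl(1) cl2 by (simp add: a_minus_def R.l_distr R.l_minus)
  moreover have "(?Q \<oplus>\<^bsub>series_ring N\<^esub> ?E) \<ominus>\<^bsub>series_ring N\<^esub> ?E = ?Q"
    using cl(1) cl2 by (simp add: a_minus_def R.a_assoc R.r_neg)
  ultimately show ?thesis by simp
qed

theorem prod_one_minus_exp_mult_partition_series:
  assumes "finite S" "r ` S \<subseteq> pos_roots N"
  shows "finprod (series_ring N) (\<lambda>x. \<one>\<^bsub>series_ring N\<^esub> \<ominus>\<^bsub>series_ring N\<^esub> fexp (- r x)) S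
    \<otimes>\<^bsub>series_ring N\<^esub> partition_series r S = \<one>\<^bsub>series_ring N\<^esub>"
  using assms
proof (induction S rule: finite_induct)
  case empty
  interpret R: cring "series_ring N" by (rule cring_series_ring)
  have "partitions r {} \<mu> = (if \<mu> = 0 then {\<lambda>_. 0} else {})" for \<mu>
    by (auto simp: partitions_def exponents_def neg_sum_def zero_fun_def)
  then have "partition_series r {} = \<one>\<^bsub>series_ring N\<^esub>"
    by (auto simp: partition_series_def series_ring_def fexp_def fun_eq_iff)
  then show ?case by simp
next
  case (insert x S)
  interpret R: cring "series_ring N" by (rule cring_series_ring)
  let ?f = "\<lambda>x. \<one>\<^bsub>series_ring N\<^esub> \<ominus>\<^bsub>series_ring N\<^esub> fexp (- r x)"
  have f: "?f y \<in> carrier (series_ring N)" if "y \<in> insert x S" for y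
    using that insert.prems by (auto intro!: R.minus_closed fexp_closed neg_root_in_neg_cone)
  have cl: "partition_series r (insert x S) \<in> carrier (series_ring N)"
    using insert by (intro partition_series_closed) auto
  have "finprod (series_ring N) ?f (insert x S) = ?f x \<otimes>\<^bsub>series_ring N\<^esub> finprod (series_ring N) ?f S"
    using insert.hyps f by (intro R.finprod_insert) auto
  also have "\<dots> = finprod (series_ring N) ?f S \<otimes>\<^bsub>series_ring N\<^esub> ?f x"
    by (rule comm_series_ring)
  finally have "finprod (series_ring N) ?f (insert x S) \<otimes>\<^bsub>series_ring N\<^esub> partition_series r (insert x S) =
      finprod (series_ring N) ?f S \<otimes>\<^bsub>series_ring N\<^esub> (?f x \<otimes>\<^bsub>series_ring N\<^esub> partition_series r (insert x S))"
    by (simp only: assoc_series_ring)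
  also have "\<dots> = \<one>\<^bsub>series_ring N\<^esub>"
    unfolding one_minus_exp_mult_partition_series[OF insert.hyps(1,2) insert.prems]
    using insert.prems by (intro insert.IH) auto
  finally show ?case .
qed

section \<open>Characters from a basis of weight vectors\<close>

lemma weights_eqI:
  assumes "\<xi> \<in> weights N" "\<eta> \<in> weights N" "\<And>H. H \<in> cartan N \<Longrightarrow> \<xi> H = \<eta> H"
  shows "\<xi> = \<eta>"
proof
  fix H show "\<xi> H = \<eta> H" using assms by (cases "H \<in> cartan N") (auto simp: weights_def)
qed

text \<open>The situation of a module with a basis \<open>B\<close> of weight vectors \<open>b\<close> of weights \<open>wt b\<close>. The
  operation \<open>act H\<close> is defined on all functions, so its linearity on the span of \<open>B\<close> is made part of
  the last assumption.\<close>

locale weight_basis =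
  fixes N :: nat
    and act :: "complex mat \<Rightarrow> ('a \<Rightarrow> complex) \<Rightarrow> 'a \<Rightarrow> complex"
    and B :: "('a \<Rightarrow> complex) set"
    and wt :: "('a \<Rightarrow> complex) \<Rightarrow> weight"
  assumes indep: "cfun.independent B"
    and wt: "b \<in> B \<Longrightarrow> wt b \<in> weights N"
    and finite_fibre: "finite {b \<in> B. wt b = \<xi>}"
    and act_combination: "finite D \<Longrightarrow> D \<subseteq> B \<Longrightarrow> H \<in> cartan N \<Longrightarrow>
      act H (\<Sum>b\<in>D. cscale (a b) b) = (\<Sum>b\<in>D. cscale (a b * wt b H) b)"
begin

abbreviation coeff where "coeff \<equiv> cfun.representation B"

abbreviation L where "L \<equiv> cfun.span B"

lemma expand: "f \<in> L \<Longrightarrow> (\<Sum>b | coeff f b \<noteq> 0. cscale (coeff f b) b) = f"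
  by (rule cfun.sum_nonzero_representation_eq[OF indep])

lemma coeff_eqD: "f \<in> L \<Longrightarrow> g \<in> L \<Longrightarrow> coeff f = coeff g \<Longrightarrow> f = g"
proof -
  assume "f \<in> L" "g \<in> L" and eq: "coeff f = coeff g"
  have "f = (\<Sum>b | coeff g b \<noteq> 0. cscale (coeff g b) b)"
    using expand[OF \<open>f \<in> L\<close>] unfolding eq by (rule sym)
  also have "\<dots> = g" by (rule expand[OF \<open>g \<in> L\<close>])
  finally show "f = g" .
qed

lemma act_in_span:
  assumes "f \<in> L" "H \<in> cartan N"
  shows "act H f = (\<Sum>b | coeff f b \<noteq> 0. cscale (coeff f b * wt b H) b)"
proof -
  have "{b. coeff f b \<noteq> 0} \<subseteq> B" by (auto dest: cfun.representation_ne_zero)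
  from act_combination[OF cfun.finite_representation this assms(2), of "coeff f"]
  show ?thesis unfolding expand[OF assms(1)] .
qed

lemma coeff_act:
  assumes "f \<in> L" "H \<in> cartan N"
  shows "act H f \<in> L" "coeff (act H f) b = coeff f b * wt b H"
proof -
  let ?D = "{b. coeff f b \<noteq> 0}"
  have D: "?D \<subseteq> B" by (auto dest: cfun.representation_ne_zero)
  have terms: "cscale (coeff f d * wt d H) d \<in> L" if "d \<in> ?D" for d
    using that D by (auto intro: cfun.span_scale cfun.span_base)
  then show "act H f \<in> L" unfolding act_in_span[OF assms] by (rule cfun.span_sum)
  have "coeff (act H f) b = (\<Sum>d\<in>?D. coeff (cscale (coeff f d * wt d H) d) b)"
    unfolding act_in_span[OF assms] using terms by (subst cfun.representation_sum[OF indep]) auto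
  also have "\<dots> = (\<Sum>d\<in>?D. if b = d then coeff f b * wt b H else 0)"
    using D by (intro sum.cong)
      (auto simp: cfun.representation_scale[OF indep] cfun.span_base cfun.representation_basis[OF indep])
  also have "\<dots> = coeff f b * wt b H"
    by (simp add: cfun.finite_representation)
  finally show "coeff (act H f) b = coeff f b * wt b H" .
qed

text \<open>Comparing coefficients in \<open>act H f = \<xi>(H) f\<close> gives \<open>wt b H = \<xi>(H)\<close> for all \<open>H\<close> whenever \<open>b\<close>
  occurs in \<open>f\<close>.\<close>

lemma weight_space_iff:
  assumes "\<xi> \<in> weights N"
  shows "f \<in> weight_space N act L \<xi> \<longleftrightarrow> f \<in> L \<and> (\<forall>b. coeff f b \<noteq> 0 \<longrightarrow> wt b = \<xi>)"
proof safe
  assume f: "f \<in> weight_space N act L \<xi>"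
  then show fL: "f \<in> L" by (simp add: weight_space_def)
  fix b assume b: "coeff f b \<noteq> 0"
  then have "b \<in> B" by (rule cfun.representation_ne_zero)
  moreover have "wt b H = \<xi> H" if H: "H \<in> cartan N" for H
  proof -
    have "coeff f b * wt b H = coeff (cscale (\<xi> H) f) b"
      using f H coeff_act(2)[OF fL H] by (simp add: weight_space_def)
    also have "\<dots> = \<xi> H * coeff f b" by (simp add: cfun.representation_scale[OF indep fL])
    finally show ?thesis using b by simp
  qed
  ultimately show "wt b = \<xi>" using wt assms by (intro weights_eqI) auto
next
  assume fL: "f \<in> L" and ws: "\<forall>b. coeff f b \<noteq> 0 \<longrightarrow> wt b = \<xi>"
  have "act H f = cscale (\<xi> H) f" if H: "H \<in> cartan N" for H
  proof (rule coeff_eqD)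
    show "act H f \<in> L" "cscale (\<xi> H) f \<in> L"
      using coeff_act(1)[OF fL H] fL by (auto intro: cfun.span_scale)
    show "coeff (act H f) = coeff (cscale (\<xi> H) f)"
      using ws by (auto simp: fun_eq_iff coeff_act(2)[OF fL H] cfun.representation_scale[OF indep fL])
  qed
  then show "f \<in> weight_space N act L \<xi>" using fL by (simp add: weight_space_def)
qed

lemma weight_space_eq_span:
  assumes "\<xi> \<in> weights N"
  shows "weight_space N act L \<xi> = cfun.span {b \<in> B. wt b = \<xi>}"
proof (intro equalityI subsetI)
  fix f assume "f \<in> weight_space N act L \<xi>"
  then have f: "f \<in> L" "\<And>b. coeff f b \<noteq> 0 \<Longrightarrow> wt b = \<xi>" using weight_space_iff[OF assms, of f] by blast+
  have "(\<Sum>b | coeff f b \<noteq> 0. cscale (coeff f b) b) \<in> cfun.span {b \<in> B. wt b = \<xi>}"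
    using f(2) by (intro cfun.span_sum cfun.span_scale cfun.span_base)
      (auto dest: cfun.representation_ne_zero)
  then show "f \<in> cfun.span {b \<in> B. wt b = \<xi>}" using expand[OF f(1)] by simp
next
  fix f assume f: "f \<in> cfun.span {b \<in> B. wt b = \<xi>}"
  have "coeff f = cfun.representation {b \<in> B. wt b = \<xi>} f"
    by (rule cfun.representation_extend[OF indep f]) auto
  moreover have "f \<in> L" using f cfun.span_mono[of "{b \<in> B. wt b = \<xi>}" B] by blast
  ultimately show "f \<in> weight_space N act L \<xi>"
    unfolding weight_space_iff[OF assms] by (auto dest: cfun.representation_ne_zero)
qed

theorem ch_eq: "ch N act L \<xi> = int (card {b \<in> B. wt b = \<xi>})"
proof (cases "\<xi> \<in> weights N")
  case True
  have "cfun.independent {b \<in> B. wt b = \<xi>}" by (rule cfun.independent_mono[OF indep]) auto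
  then show ?thesis
    using True by (simp add: ch_def weight_space_eq_span cfun.dim_eq_card_independent)
next
  case False
  then have "{b \<in> B. wt b = \<xi>} = {}" using wt by auto
  then show ?thesis using False unfolding ch_def by (simp only: if_False card.empty of_nat_0)
qed

text \<open>Basis vectors of weight \<open>\<xi>\<close> occur in no component other than the one of weight \<open>\<xi>\<close>. So the
  coefficients of the components, and with them the components, are determined by \<open>f\<close>.\<close>

lemma component_unique:
  assumes comp: "\<And>\<xi>. \<xi> \<in> weights N \<Longrightarrow> \<phi> \<xi> \<in> weight_space N act L \<xi>"
    and fin: "finite {\<xi>. \<phi> \<xi> \<noteq> 0}" and f: "f = (\<Sum>\<xi> | \<phi> \<xi> \<noteq> 0. \<phi> \<xi>)"
    and off: "\<And>\<xi>. \<xi> \<notin> weights N \<Longrightarrow> \<phi> \<xi> = 0"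
    and \<xi>: "\<xi> \<in> weights N"
  shows "coeff (\<phi> \<xi>) b = (if wt b = \<xi> then coeff f b else 0)"
proof -
  have L: "\<phi> \<eta> \<in> L" for \<eta>
    using comp[of \<eta>] off[of \<eta>] cfun.span_zero by (cases "\<eta> \<in> weights N") (simp_all add: weight_space_iff)
  have zero: "coeff (\<phi> \<eta>) b = 0" if "wt b \<noteq> \<eta>" for \<eta>
    using comp[of \<eta>] off[of \<eta>] that
    by (cases "\<eta> \<in> weights N") (auto simp: weight_space_iff cfun.representation_zero)
  have "coeff f b = (\<Sum>\<eta> | \<phi> \<eta> \<noteq> 0. coeff (\<phi> \<eta>) b)"
    unfolding f using L by (subst cfun.representation_sum[OF indep]) auto
  also have "\<dots> = (\<Sum>\<eta> | \<phi> \<eta> \<noteq> 0. if \<eta> = wt b then coeff (\<phi> \<eta>) b else 0)"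
    using zero by (intro sum.cong) auto
  also have "\<dots> = coeff (\<phi> (wt b)) b"
    using fin by (simp add: sum.delta cfun.representation_zero)
  finally show ?thesis using zero[of \<xi>] by (cases "wt b = \<xi>") simp_all
qed

theorem has_character: "has_character N act L"
  unfolding has_character_def
proof (intro conjI ballI)
  show "cfun.subspace L" by simp
  fix \<xi> assume \<xi>: "\<xi> \<in> weights N"
  show "cfun.subspace (weight_space N act L \<xi>)" using \<xi> by (simp add: weight_space_eq_span)
  show "\<exists>C. finite C \<and> weight_space N act L \<xi> \<subseteq> cfun.span C"
    using \<xi> finite_fibre by (auto simp: weight_space_eq_span)
next
  fix f assume f: "f \<in> L"
  let ?P = "\<lambda>\<phi>. (\<forall>\<xi>\<in>weights N. \<phi> \<xi> \<in> weight_space N act L \<xi>) \<and>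
    (\<forall>\<xi>. \<xi> \<notin> weights N \<longrightarrow> \<phi> \<xi> = 0) \<and> finite {\<xi>. \<phi> \<xi> \<noteq> 0} \<and> f = (\<Sum>\<xi> | \<phi> \<xi> \<noteq> 0. \<phi> \<xi>)"
  let ?D = "{b. coeff f b \<noteq> 0}"
  have D: "finite ?D" "?D \<subseteq> B" by (auto simp: cfun.finite_representation dest: cfun.representation_ne_zero)
  \<comment> \<open>The components collect the terms of the expansion of \<open>f\<close> by weight.\<close>
  define \<phi> where "\<phi> \<xi> = (\<Sum>b\<in>{b \<in> ?D. wt b = \<xi>}. cscale (coeff f b) b)" for \<xi>
  have supp: "{\<xi>. \<phi> \<xi> \<noteq> 0} \<subseteq> wt ` ?D"
    unfolding \<phi>_def by (auto elim!: sum.not_neutral_contains_not_neutral)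
  show "\<exists>!\<phi>. ?P \<phi>"
  proof (rule ex1I[of _ \<phi>])
    have "\<phi> \<xi> \<in> weight_space N act L \<xi>" if "\<xi> \<in> weights N" for \<xi>
      unfolding weight_space_eq_span[OF that] \<phi>_def using D
      by (intro cfun.span_sum cfun.span_scale cfun.span_base) auto
    moreover have "\<phi> \<xi> = 0" if "\<xi> \<notin> weights N" for \<xi>
      using supp D wt that by blast
    moreover have "f = (\<Sum>\<xi> | \<phi> \<xi> \<noteq> 0. \<phi> \<xi>)"
    proof -
      have "(\<Sum>\<xi> | \<phi> \<xi> \<noteq> 0. \<phi> \<xi>) = (\<Sum>\<xi>\<in>wt ` ?D. \<phi> \<xi>)"
        using D supp by (intro sum.mono_neutral_left) auto
      also have "\<dots> = (\<Sum>b\<in>?D. cscale (coeff f b) b)"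
        unfolding \<phi>_def using D by (intro sum.group) auto
      finally show ?thesis using expand[OF f] by simp
    qed
    moreover have "finite {\<xi>. \<phi> \<xi> \<noteq> 0}" using supp D(1) finite_surj by blast
    ultimately show P: "?P \<phi>" by blast
    fix \<psi> assume Q: "?P \<psi>"
    show "\<psi> = \<phi>"
    proof
      fix \<xi>
      show "\<psi> \<xi> = \<phi> \<xi>"
      proof (cases "\<xi> \<in> weights N")
        case True
        have "coeff (\<psi> \<xi>) b = coeff (\<phi> \<xi>) b" for b
        proof -
          have "coeff (\<psi> \<xi>) b = (if wt b = \<xi> then coeff f b else 0)"
            using Q True by (intro component_unique) blast+
          moreover have "coeff (\<phi> \<xi>) b = (if wt b = \<xi> then coeff f b else 0)"
            using P True by (intro component_unique) blast+
          ultimately show ?thesis by simp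
        qed
        then show ?thesis
          using P Q True weight_space_iff[OF True] by (intro coeff_eqD) (blast | rule ext)+
      next
        case False
        then show ?thesis using P Q by metis
      qed
    qed
  qed
qed

end

section \<open>The monomial basis of the coordinate ring\<close>

text \<open>Dedekind's independence of characters, for functions extended by zero off the set \<open>S\<close> on
  which they are multiplicative. In a relation between \<open>g\<close> and the functions in \<open>D\<close>, evaluation at
  \<open>y v\<close> and subtraction of \<open>g(y)\<close> times the evaluation at \<open>v\<close> eliminates \<open>g\<close>; by induction
  \<open>a(f) (f(y) - g(y))\<close> vanishes for all \<open>y\<close>, and some \<open>y\<close> separates \<open>f\<close> from \<open>g\<close>.\<close>

theorem independent_multiplicative:
  fixes F :: "('a \<Rightarrow> complex) set"
  assumes mult: "\<And>f u v. f \<in> F \<Longrightarrow> u \<in> S \<Longrightarrow> v \<in> S \<Longrightarrow> f (m u v) = f u * f v"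
    and closed: "\<And>u v. u \<in> S \<Longrightarrow> v \<in> S \<Longrightarrow> m u v \<in> S"
    and unit: "\<And>f. f \<in> F \<Longrightarrow> f e \<noteq> 0"
    and off: "\<And>f v. f \<in> F \<Longrightarrow> v \<notin> S \<Longrightarrow> f v = 0"
  shows "cfun.independent F"
proof -
  have key: "\<forall>f\<in>D. a f = 0"
    if "finite D" "D \<subseteq> F" "\<And>v. (\<Sum>f\<in>D. a f * f v) = 0" for D and a :: "('a \<Rightarrow> complex) \<Rightarrow> complex"
    using that
  proof (induction D arbitrary: a rule: finite_induct)
    case (insert g D)
    have F: "g \<in> F" "D \<subseteq> F" using insert.prems(1) by auto
    have D: "\<forall>f\<in>D. a f * (f y - g y) = 0" if y: "y \<in> S" for y
    proof (rule insert.IH[OF F(2)])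
      fix v
      show "(\<Sum>f\<in>D. a f * (f y - g y) * f v) = 0"
      proof (cases "v \<in> S")
        case True
        have "a g * g y * g v + (\<Sum>f\<in>D. a f * f y * f v) = (\<Sum>f\<in>insert g D. a f * f (m y v))"
          using insert.hyps F mult[OF _ y True] by (auto simp: mult.assoc intro!: sum.cong)
        also have "\<dots> = 0" by (rule insert.prems(2))
        finally have 1: "a g * g y * g v + (\<Sum>f\<in>D. a f * f y * f v) = 0" .
        have 2: "g y * (a g * g v + (\<Sum>f\<in>D. a f * f v)) = 0"
          using insert.prems(2)[of v] insert.hyps by simp
        have "(\<Sum>f\<in>D. a f * (f y - g y) * f v) =
          (a g * g y * g v + (\<Sum>f\<in>D. a f * f y * f v)) - g y * (a g * g v + (\<Sum>f\<in>D. a f * f v))"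
          by (simp add: algebra_simps sum_distrib_left sum_subtractf)
        then show ?thesis using 1 2 by simp
      next
        case False
        then show ?thesis using F off by (intro sum.neutral) auto
      qed
    qed
    have aD: "a f = 0" if "f \<in> D" for f
    proof -
      have "f \<noteq> g" using that insert.hyps by auto
      then obtain y where y: "f y \<noteq> g y" by (auto simp: fun_eq_iff)
      then have "y \<in> S" using off F that by (metis subsetD)
      then have "a f * (f y - g y) = 0" using D that by blast
      then show ?thesis using y by simp
    qed
    then have "a g * g e = 0" using insert.prems(2)[of e] insert.hyps by simp
    then show ?case using aD unit[OF F(1)] by simp
  qed simp
  show ?thesis
    unfolding cfun.independent_explicit_module
  proof (intro allI impI)
    fix D u f
    assume D: "finite D" "D \<subseteq> F" and z: "(\<Sum>f\<in>D. cscale (u f) f) = 0" and f: "f \<in> D"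
    have "(\<Sum>f\<in>D. u f * f v) = (\<Sum>f\<in>D. cscale (u f) f) v" for v
      using D(1) by (induction D rule: finite_induct) (auto simp: cscale_def)
    then show "u f = 0" using key[OF D, of u] z f by simp
  qed
qed

text \<open>The coordinate whose weight is \<open>- root_at N (i, j)\<close>. For a position in the block
  \<open>M\<^sub>p\<^sub>,\<^sub>n\<close> of \<open>\<uu>'\<^sup>+\<close> this is an entry of the transpose of \<open>X\<close>.\<close>

definition coord :: "nat \<Rightarrow> nat \<Rightarrow> nat \<times> nat \<Rightarrow> complex mat \<times> complex mat \<Rightarrow> complex" where
  "coord n p = (\<lambda>(i, j) v. if i < p then fst v $$ (j - p, i) else snd v $$ (i - p, j - (p + n)))"

definition point :: "nat \<Rightarrow> nat \<Rightarrow> nat \<Rightarrow> (nat \<times> nat \<Rightarrow> complex) \<Rightarrow> complex mat \<times> complex mat" where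
  "point n p q a = (Matrix.mat n p (\<lambda>(k, i). a (i, p + k)), Matrix.mat n q (\<lambda>(k, j). a (p + k, p + n + j)))"

lemma point_in_V: "point n p q a \<in> V n p q"
  by (simp add: point_def V_def)

lemma coord_point: "x \<in> nc_index n p q \<Longrightarrow> coord n p x (point n p q a) = a x"
  by (auto simp: nc_index_def coord_def point_def)

definition monom :: "nat \<Rightarrow> nat \<Rightarrow> nat \<Rightarrow> (nat \<times> nat \<Rightarrow> nat) \<Rightarrow> fun_V" where
  "monom n p q c = (\<lambda>v. if v \<in> V n p q then \<Prod>x\<in>nc_index n p q. coord n p x v ^ c x else 0)"

definition monoms :: "nat \<Rightarrow> nat \<Rightarrow> nat \<Rightarrow> fun_V set" where
  "monoms n p q = monom n p q ` exponents (nc_index n p q)"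

lemma monom_point:
  "monom n p q c (point n p q a) = (\<Prod>x\<in>nc_index n p q. a x ^ c x)"
  by (simp add: monom_def point_in_V coord_point)

text \<open>Monomials are multiplicative for the entrywise product of points of \<open>V\<close>, with the point whose
  coordinates are all 1 as unit.\<close>

lemma independent_monoms: "cfun.independent (monoms n p q)"
proof (rule independent_multiplicative[where S = "V n p q" and e = "point n p q (\<lambda>_. 1)"
      and m = "\<lambda>u v. point n p q (\<lambda>x. coord n p x u * coord n p x v)"])
  show "f (point n p q (\<lambda>_. 1)) \<noteq> 0" if "f \<in> monoms n p q" for f
    using that by (auto simp: monoms_def monom_point)
  show "f (point n p q (\<lambda>x. coord n p x u * coord n p x v)) = f u * f v"
    if F: "f \<in> monoms n p q" and uv: "u \<in> V n p q" "v \<in> V n p q" for f u v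
  proof -
    obtain c where f: "f = monom n p q c" using F by (auto simp: monoms_def)
    show ?thesis unfolding f monom_point
      using uv by (simp add: monom_def power_mult_distrib prod.distrib)
  qed
qed (auto simp: point_in_V monoms_def monom_def)

text \<open>The exponent of a coordinate is read off at the point where this coordinate is 2 and all
  others are 1.\<close>

lemma inj_on_monom: "inj_on (monom n p q) (exponents (nc_index n p q))"
proof (rule inj_onI, rule ext, rule ccontr)
  fix c d x
  assume c: "c \<in> exponents (nc_index n p q)" and d: "d \<in> exponents (nc_index n p q)"
    and eq: "monom n p q c = monom n p q d" and ne: "c x \<noteq> d x"
  have "c x = d x" if "x \<notin> nc_index n p q" using c d that unfolding exponents_def by (metis (mono_tags, lifting) mem_Collect_eq)
  then have x: "x \<in> nc_index n p q" using ne by blast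
  have "monom n p q c (point n p q (\<lambda>y. if y = x then 2 else 1)) = 2 ^ c x" for c
  proof -
    have "(\<Prod>y\<in>nc_index n p q. (if y = x then 2 else 1) ^ c y) =
      (\<Prod>y\<in>nc_index n p q. if y = x then 2 ^ c y else (1::complex))"
      by (intro prod.cong) auto
    also have "\<dots> = 2 ^ c x" using x by (simp add: finite_nc_index prod.delta)
    finally show ?thesis by (simp add: monom_point)
  qed
  from this[of c] this[of d] have "(2::complex) ^ c x = 2 ^ d x" using eq by simp
  then have "norm ((2::complex) ^ c x) = norm ((2::complex) ^ d x)" by simp
  then have "(2::real) ^ c x = 2 ^ d x" by (simp add: norm_power)
  then show False using ne by simp
qed

lemma poly_V_zero_off_V: "f \<in> poly_V n p q \<Longrightarrow> v \<notin> V n p q \<Longrightarrow> f v = 0"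
  by (induction rule: poly_V.induct) auto

lemma subspace_poly_V: "cfun.subspace (poly_V n p q)"
proof (rule cfun.subspaceI)
  show "0 \<in> poly_V n p q" using poly_V.const[of n p q 0] by (simp add: zero_fun_def)
  show "f + g \<in> poly_V n p q" if "f \<in> poly_V n p q" "g \<in> poly_V n p q" for f g
    using poly_V.add[OF that] by (simp add: plus_fun_def)
  show "cscale c f \<in> poly_V n p q" if f: "f \<in> poly_V n p q" for c f
  proof -
    have "cscale c f = (\<lambda>v. (if v \<in> V n p q then c else 0) * f v)"
      using poly_V_zero_off_V[OF f] by (auto simp: cscale_def)
    then show ?thesis using poly_V.mult[OF poly_V.const[of n p q c] f] by simp
  qed
qed

lemma coord_in_poly_V:
  assumes "x \<in> nc_index n p q"
  shows "(\<lambda>v. if v \<in> V n p q then coord n p x v else 0) \<in> poly_V n p q"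
proof -
  obtain i j where x: "x = (i, j)" by (cases x)
  show ?thesis
  proof (cases "i < p")
    case True
    then show ?thesis using poly_V.coord_X[of "j - p" n i p q] assms
      unfolding x coord_def by (auto simp: nc_index_def cong: if_cong)
  next
    case False
    then show ?thesis using poly_V.coord_Y[of "i - p" n "j - (p + n)" q p] assms
      unfolding x coord_def by (auto simp: nc_index_def cong: if_cong)
  qed
qed

lemma monom_in_poly_V: "monom n p q c \<in> poly_V n p q"
proof -
  have one: "(\<lambda>v. if v \<in> V n p q then 1 else 0) \<in> poly_V n p q" by (rule poly_V.const)
  have pow: "(\<lambda>v. if v \<in> V n p q then coord n p x v ^ k else 0) \<in> poly_V n p q"
    if "x \<in> nc_index n p q" for x k
  proof (induction k)
    case 0
    then show ?case using one by (simp cong: if_cong)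
  next
    case (Suc k)
    from poly_V.mult[OF coord_in_poly_V[OF that] Suc] show ?case
      by (rule back_subst[of "\<lambda>f. f \<in> poly_V n p q"]) auto
  qed
  have "(\<lambda>v. if v \<in> V n p q then \<Prod>x\<in>T. coord n p x v ^ c x else 0) \<in> poly_V n p q"
    if "T \<subseteq> nc_index n p q" for T
    using finite_subset[OF that finite_nc_index] that
  proof (induction T rule: finite_induct)
    case empty
    then show ?case using one by (simp cong: if_cong)
  next
    case (insert x T)
    then have "x \<in> nc_index n p q" "T \<subseteq> nc_index n p q" by auto
    from poly_V.mult[OF pow[OF this(1), of "c x"] insert.IH[OF this(2)]] show ?case
      by (rule back_subst[of "\<lambda>f. f \<in> poly_V n p q"]) (use insert.hyps in auto)
  qed
  then show ?thesis by (simp add: monom_def)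
qed

lemma monom_mult: "monom n p q c v * monom n p q d v = monom n p q (\<lambda>x. c x + d x) v"
  by (simp add: monom_def power_add prod.distrib)

text \<open>The product is bilinear, so it suffices to multiply monomials.\<close>

lemma span_monoms_mult:
  assumes f: "f \<in> cfun.span (monoms n p q)" and g: "g \<in> cfun.span (monoms n p q)"
  shows "(\<lambda>v. f v * g v) \<in> cfun.span (monoms n p q)"
proof -
  let ?L = "cfun.span (monoms n p q)"
  have sub: "cfun.subspace {h. (\<lambda>v. h v * k v) \<in> ?L}" for k
  proof (rule cfun.subspaceI; clarify)
    show "(\<lambda>v. 0 v * k v) \<in> ?L" using cfun.span_zero[of "monoms n p q"] by (simp add: zero_fun_def)
    show "(\<lambda>v. (x + y) v * k v) \<in> ?L" if "(\<lambda>v. x v * k v) \<in> ?L" "(\<lambda>v. y v * k v) \<in> ?L" for x y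
      using cfun.span_add[OF that] by (simp add: plus_fun_def distrib_right)
    show "(\<lambda>v. cscale c x v * k v) \<in> ?L" if "(\<lambda>v. x v * k v) \<in> ?L" for c x
      using cfun.span_scale[OF that, of c] by (simp add: cscale_def mult.assoc)
  qed
  have "(\<lambda>v. h v * g v) \<in> ?L" if h: "h \<in> monoms n p q" for h
  proof -
    have base: "(\<lambda>v. k v * h v) \<in> ?L" if k: "k \<in> monoms n p q" for k
    proof -
      obtain c d where "h = monom n p q c" "k = monom n p q d" "c \<in> exponents (nc_index n p q)"
        "d \<in> exponents (nc_index n p q)" using h k by (auto simp: monoms_def)
      moreover from this have "(\<lambda>x. d x + c x) \<in> exponents (nc_index n p q)" by (simp add: exponents_def)
      ultimately show ?thesis by (auto simp: monom_mult monoms_def intro: cfun.span_base)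
    qed
    have "(\<lambda>v. g v * h v) \<in> ?L"
      using cfun.span_induct[OF g sub[of h]] base by blast
    then show ?thesis by (simp add: mult.commute)
  qed
  then show ?thesis using cfun.span_induct[OF f sub[of g]] by blast
qed

lemma poly_V_eq_span: "poly_V n p q = cfun.span (monoms n p q)"
proof
  show "cfun.span (monoms n p q) \<subseteq> poly_V n p q"
    using monom_in_poly_V subspace_poly_V by (intro cfun.span_minimal) (auto simp: monoms_def)
  have coord: "(\<lambda>v. if v \<in> V n p q then coord n p x v else 0) \<in> cfun.span (monoms n p q)"
    if x: "x \<in> nc_index n p q" for x
  proof -
    let ?d = "\<lambda>y. if y = x then 1 else (0::nat)"
    have "(\<Prod>y\<in>nc_index n p q. coord n p y v ^ ?d y) = coord n p x v" for v
    proof -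
      have "(\<Prod>y\<in>nc_index n p q. coord n p y v ^ ?d y) =
        (\<Prod>y\<in>nc_index n p q. if y = x then coord n p y v else 1)" by (intro prod.cong) auto
      then show ?thesis using x by (simp add: finite_nc_index prod.delta)
    qed
    then have "monom n p q ?d = (\<lambda>v. if v \<in> V n p q then coord n p x v else 0)"
      unfolding monom_def by (simp only:)
    moreover have "?d \<in> exponents (nc_index n p q)" using x by (simp add: exponents_def)
    ultimately show ?thesis by (metis cfun.span_base imageI monoms_def)
  qed
  show "poly_V n p q \<subseteq> cfun.span (monoms n p q)"
  proof
    fix f assume "f \<in> poly_V n p q"
    then show "f \<in> cfun.span (monoms n p q)"
    proof (induction rule: poly_V.induct)
      case (const c)
      have "cscale c (monom n p q (\<lambda>_. 0)) \<in> cfun.span (monoms n p q)"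
        unfolding monoms_def
        by (intro cfun.span_scale cfun.span_base imageI) (simp add: exponents_def)
      moreover have "cscale c (monom n p q (\<lambda>_. 0)) = (\<lambda>v. if v \<in> V n p q then c else 0)"
        by (auto simp: monom_def cscale_def)
      ultimately show ?case by simp
    next
      case (coord_X k i)
      then show ?case using coord[of "(i, p + k)"] by (simp add: nc_index_def coord_def cong: if_cong)
    next
      case (coord_Y k j)
      then show ?case using coord[of "(p + k, p + n + j)"] by (simp add: nc_index_def coord_def cong: if_cong)
    next
      case (add f g)
      then show ?case using cfun.span_add[of f _ g] by (simp add: plus_fun_def)
    next
      case (mult f g)
      then show ?case by (intro span_monoms_mult)
    qed
  qed
qed

section \<open>The torus action on monomials\<close>

lemma mat_diag_pow: "mat_diag m f ^\<^sub>m k = mat_diag m (\<lambda>i. (f i :: complex) ^ k)"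
proof (induction k)
  case 0
  then show ?case using mat_diag_dim[of m f] by (simp del: mat_diag_dim)
next
  case (Suc k)
  then show ?case by (simp add: mult.commute)
qed

lemma mexp_mat_diag: "mexp (mat_diag m f) = mat_diag m (\<lambda>i. exp (f i))"
proof (rule eq_matI)
  fix i j assume "i < dim_row (mat_diag m (\<lambda>i. exp (f i)))" "j < dim_col (mat_diag m (\<lambda>i. exp (f i)))"
  then have ij: "i < m" "j < m" by (auto simp: mat_diag_def)
  have "(\<Sum>k. (if i = j then f j ^ k else 0) / fact k) = (if i = j then exp (f j) else 0)"
    by (simp add: exp_def scaleR_conv_of_real divide_inverse mult.commute)
  moreover have "(mat_diag m f ^\<^sub>m k) $$ (i, j) = (if i = j then f j ^ k else 0)" for k
    using ij by (simp add: mat_diag_pow) (simp add: mat_diag_def)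
  ultimately show "mexp (mat_diag m f) $$ (i, j) = mat_diag m (\<lambda>i. exp (f i)) $$ (i, j)"
    using ij by (simp add: mexp_def) (simp add: mat_diag_def)
qed (auto simp: mexp_def mat_diag_def)

lemma minv_eqI:
  assumes A: "A \<in> carrier_mat m m" and B: "B \<in> carrier_mat m m" and AB: "A * B = 1\<^sub>m m" "B * A = 1\<^sub>m m"
  shows "minv A = B"
proof (cases "mat_inverse A")
  case None
  have "A \<in> Units (ring_mat TYPE(complex) m ())"
    using A B AB unfolding Units_def by (auto simp: ring_mat_simps)
  then show ?thesis using mat_inverse(1)[OF A None, of "()"] by blast
next
  case (Some C)
  then have C: "C * A = 1\<^sub>m m" "C \<in> carrier_mat m m" using mat_inverse(2)[OF A Some] by auto
  have "C = C * (A * B)" using AB C by simp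
  also have "\<dots> = (C * A) * B" using A B C by (intro assoc_mult_mat[symmetric])
  also have "\<dots> = B" using C B by simp
  finally show ?thesis using Some by (simp add: minv_def)
qed

lemma minv_mat_diag:
  assumes "\<And>i. f i \<noteq> 0"
  shows "minv (mat_diag m f) = mat_diag m (\<lambda>i. inverse (f i))"
  using assms by (intro minv_eqI[of _ m]) auto

lemma transpose_mat_diag: "transpose_mat (mat_diag m f) = mat_diag m f"
  by (auto simp: mat_diag_def)

text \<open>The point \<open>exp(- t H) v\<close> at which the derived action of \<open>H\<close> evaluates a function before
  differentiating in \<open>t\<close>.\<close>

definition torus_flow :: "nat \<Rightarrow> nat \<Rightarrow> nat \<Rightarrow> complex mat \<Rightarrow> complex \<Rightarrow> complex mat \<times> complex mat \<Rightarrow> complex mat \<times> complex mat" where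
  "torus_flow n p q H t = act_V (inv_triple (mexp (t \<cdot>\<^sub>m diag_block p n H),
     mexp (t \<cdot>\<^sub>m - transpose_mat (diag_block 0 p H)), mexp (t \<cdot>\<^sub>m diag_block (p + n) q H)))"

lemma diag_block_diagonal:
  assumes "H \<in> cartan N" "s + m \<le> N"
  shows "diag_block s m H = mat_diag m (\<lambda>i. H $$ (s + i, s + i))"
  using assms by (intro eq_matI) (auto simp: diag_block_def mat_diag_def cartan_def sl_def diagonal_mat_def)

lemma torus_flow_eq:
  assumes H: "H \<in> cartan (n + p + q)" and X: "X \<in> carrier_mat n p" and Y: "Y \<in> carrier_mat n q"
  shows "torus_flow n p q H t (X, Y) =
    (Matrix.mat n p (\<lambda>(k, i). exp (t * H $$ (p + k, p + k)) * X $$ (k, i) * exp (- (t * H $$ (i, i)))),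
     Matrix.mat n q (\<lambda>(k, j). exp (- (t * H $$ (p + k, p + k))) * Y $$ (k, j) * exp (t * H $$ (p + n + j, p + n + j))))"
proof -
  have smult: "t \<cdot>\<^sub>m mat_diag m f = mat_diag m (\<lambda>i. t * f i)" for m and f :: "nat \<Rightarrow> complex"
    by (auto simp: mat_diag_def)
  have uminus: "- mat_diag m f = mat_diag m (\<lambda>i. - f i)" for m and f :: "nat \<Rightarrow> complex"
    by (auto simp: mat_diag_def)
  have d: "diag_block p n H = mat_diag n (\<lambda>i. H $$ (p + i, p + i))"
    "diag_block 0 p H = mat_diag p (\<lambda>i. H $$ (i, i))"
    "diag_block (p + n) q H = mat_diag q (\<lambda>i. H $$ (p + n + i, p + n + i))"
    using diag_block_diagonal[OF H, of p n] diag_block_diagonal[OF H, of 0 p] diag_block_diagonal[OF H, of "p + n" q]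
    by auto
  show ?thesis
    unfolding torus_flow_def d transpose_mat_diag uminus smult mexp_mat_diag inv_triple.simps act_V.simps
    using X Y
    by (simp add: minv_mat_diag transpose_mat_diag mat_diag_mult_left[of _ n p] mat_diag_mult_left[of _ n q]
        mat_diag_mult_right[of _ n p] mat_diag_mult_right[of _ n q] exp_minus)
      (auto intro!: eq_matI)
qed

lemma torus_flow_V:
  assumes H: "H \<in> cartan (n + p + q)" and v: "v \<in> V n p q"
  shows "torus_flow n p q H t v \<in> V n p q"
proof -
  obtain X Y where XY: "v = (X, Y)" "X \<in> carrier_mat n p" "Y \<in> carrier_mat n q" using v by (auto simp: V_def)
  show ?thesis unfolding XY(1) torus_flow_eq[OF H XY(2,3)] V_def by simp
qed

text \<open>In an entry of \<open>X\<close> the row scales with the \<open>\<gg>\<ll>\<^sub>n\<close> part of \<open>H\<close> and the column against the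
  \<open>\<gg>\<ll>\<^sub>p\<close> part; in an entry of \<open>Y\<close> the row scales against the \<open>\<gg>\<ll>\<^sub>n\<close> part and the column with the
  \<open>\<gg>\<ll>\<^sub>q\<close> part. Both are minus the difference of diagonal entries at the position of the coordinate.\<close>

lemma coord_torus_flow:
  assumes H: "H \<in> cartan (n + p + q)" and v: "v \<in> V n p q" and x: "x \<in> nc_index n p q"
  shows "coord n p x (torus_flow n p q H t v) = exp (- (t * root_at (n + p + q) x H)) * coord n p x v"
proof -
  obtain X Y where XY: "v = (X, Y)" "X \<in> carrier_mat n p" "Y \<in> carrier_mat n q" using v by (auto simp: V_def)
  show ?thesis
    using x H unfolding XY(1) torus_flow_eq[OF H XY(2,3)]
    by (auto simp: nc_index_def coord_def root_at_apply right_diff_distrib exp_diff exp_minus field_simps)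
qed

definition monom_weight :: "nat \<Rightarrow> nat \<Rightarrow> nat \<Rightarrow> (nat \<times> nat \<Rightarrow> nat) \<Rightarrow> weight" where
  "monom_weight n p q = neg_sum (root_at (n + p + q)) (nc_index n p q)"

lemma monom_torus_flow:
  assumes H: "H \<in> cartan (n + p + q)" and v: "v \<in> V n p q"
  shows "monom n p q c (torus_flow n p q H t v) = exp (t * monom_weight n p q c H) * monom n p q c v"
proof -
  have "exp (t * monom_weight n p q c H) =
      (\<Prod>x\<in>nc_index n p q. exp (- (t * root_at (n + p + q) x H)) ^ c x)"
    by (simp add: monom_weight_def neg_sum_def exp_of_nat_mult[symmetric] exp_sum[symmetric]
        finite_nc_index sum_distrib_left sum_negf mult_ac)
  then show ?thesis
    using v torus_flow_V[OF H v] by (simp add: monom_def coord_torus_flow[OF H v] power_mult_distrib prod.distrib)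
qed

text \<open>The weight as a function of the monomial rather than of its exponents, which are unique by
  \<open>inj_on_monom\<close>.\<close>

definition wt_of :: "nat \<Rightarrow> nat \<Rightarrow> nat \<Rightarrow> fun_V \<Rightarrow> weight" where
  "wt_of n p q b = monom_weight n p q (the_inv_into (exponents (nc_index n p q)) (monom n p q) b)"

lemma wt_of_monom: "c \<in> exponents (nc_index n p q) \<Longrightarrow> wt_of n p q (monom n p q c) = monom_weight n p q c"
  by (simp add: wt_of_def the_inv_into_f_f inj_on_monom)

lemma sum_cscale_apply: "(\<Sum>b\<in>D. cscale (a b) (b :: 'a \<Rightarrow> complex)) v = (\<Sum>b\<in>D. a b * b v)"
  by (induction D rule: infinite_finite_induct) (auto simp: cscale_def)

text \<open>Along the flow a monomial changes by the factor \<open>exp(t \<xi>(H))\<close>, \<open>\<xi>\<close> its weight, whose derivative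
  at \<open>t = 0\<close> is \<open>\<xi>(H)\<close>.\<close>

lemma levi_act_monoms:
  assumes D: "finite D" "D \<subseteq> monoms n p q" and H: "H \<in> cartan (n + p + q)"
  shows "levi_act n p q H (\<Sum>b\<in>D. cscale (a b) b) = (\<Sum>b\<in>D. cscale (a b * wt_of n p q b H) b)"
proof
  fix v
  let ?f = "\<Sum>b\<in>D. cscale (a b) b"
  have act: "levi_act n p q H ?f v = deriv (\<lambda>t. if v \<in> V n p q then ?f (torus_flow n p q H t v) else 0) 0"
    unfolding levi_act_def act_poly_def torus_flow_def derived_act.simps ..
  show "levi_act n p q H ?f v = (\<Sum>b\<in>D. cscale (a b * wt_of n p q b H) b) v"
  proof (cases "v \<in> V n p q")
    case True
    have "b (torus_flow n p q H t v) = exp (t * wt_of n p q b H) * b v" if "b \<in> D" for b t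
      using that D(2) monom_torus_flow[OF H True] wt_of_monom by (auto simp: monoms_def)
    then have "levi_act n p q H ?f v = deriv (\<lambda>t. \<Sum>b\<in>D. a b * (exp (t * wt_of n p q b H) * b v)) 0"
      unfolding act using True by (simp add: sum_cscale_apply)
    also have "\<dots> = (\<Sum>b\<in>D. a b * wt_of n p q b H * b v)"
      by (rule DERIV_imp_deriv) (auto intro!: derivative_eq_intros sum.cong)
    finally show ?thesis by (simp add: sum_cscale_apply)
  next
    case False
    then have "b v = 0" if "b \<in> D" for b using that D(2) by (auto simp: monoms_def monom_def)
    then have "(\<Sum>b\<in>D. a b * wt_of n p q b H * b v) = 0" by (intro sum.neutral) simp
    then show ?thesis unfolding act using False by (simp add: sum_cscale_apply)
  qed
qed

lemma neg_sum_in_weights: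
  assumes "r ` S \<subseteq> weights N"
  shows "neg_sum r S c \<in> weights N"
proof -
  have r: "r x \<in> weights N" if "x \<in> S" for x using that assms by auto
  have "neg_sum r S c (A + B) = neg_sum r S c A + neg_sum r S c B"
    if "A \<in> cartan N" "B \<in> cartan N" for A B
  proof -
    have "(\<Sum>x\<in>S. of_nat (c x) * r x (A + B)) = (\<Sum>x\<in>S. of_nat (c x) * r x A + of_nat (c x) * r x B)"
      using r that by (intro sum.cong) (auto simp: weights_def distrib_left)
    then show ?thesis by (simp add: neg_sum_def sum.distrib)
  qed
  moreover have "neg_sum r S c (k \<cdot>\<^sub>m A) = k * neg_sum r S c A" if "A \<in> cartan N" for k A
  proof -
    have "(\<Sum>x\<in>S. of_nat (c x) * r x (k \<cdot>\<^sub>m A)) = (\<Sum>x\<in>S. k * (of_nat (c x) * r x A))"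
      using r that by (intro sum.cong) (auto simp: weights_def)
    then show ?thesis by (simp add: neg_sum_def sum_distrib_left[symmetric])
  qed
  moreover have "neg_sum r S c A = 0" if "A \<notin> cartan N" for A
    using r that by (auto simp: neg_sum_def weights_def intro!: sum.neutral)
  ultimately show ?thesis by (simp add: weights_def)
qed

lemma root_at_in_weights:
  assumes "i < N" "j < N"
  shows "root_at N (i, j) \<in> weights N"
proof -
  have "A + B \<in> cartan N" if "A \<in> cartan N" "B \<in> cartan N" for A B
    using that by (auto simp: cartan_def sl_def tr_def diagonal_mat_def sum.distrib)
  moreover have "k \<cdot>\<^sub>m A \<in> cartan N" if "A \<in> cartan N" for k A
    using that by (auto simp: cartan_def sl_def tr_def diagonal_mat_def sum_distrib_left[symmetric])
  moreover have "dim_row A = N" "dim_col A = N" if "A \<in> cartan N" for A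
    using that by (auto simp: cartan_def sl_def)
  ultimately show ?thesis
    using assms unfolding weights_def by (auto simp: root_at_apply right_diff_distrib)
qed

lemma root_at_nc_pos: "root_at (n + p + q) ` nc_index n p q \<subseteq> pos_roots (n + p + q)"
proof clarify
  fix i j assume "(i, j) \<in> nc_index n p q"
  then have "i < j \<and> j < n + p + q" using nc_index_less by fastforce
  then show "root_at (n + p + q) (i, j) \<in> pos_roots (n + p + q)" unfolding pos_roots_eq by blast
qed

text \<open>Here the two counts meet: the coefficients of the partition series number the monomials of
  each weight.\<close>

lemma bij_betw_weight_fibre:
  "bij_betw (monom n p q) (partitions (root_at (n + p + q)) (nc_index n p q) \<xi>)
     {b \<in> monoms n p q. wt_of n p q b = \<xi>}"
  unfolding bij_betw_def
proof
  show "inj_on (monom n p q) (partitions (root_at (n + p + q)) (nc_index n p q) \<xi>)"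
    by (rule inj_on_subset[OF inj_on_monom]) (auto simp: partitions_def)
  show "monom n p q ` partitions (root_at (n + p + q)) (nc_index n p q) \<xi> = {b \<in> monoms n p q. wt_of n p q b = \<xi>}"
    by (auto simp: partitions_def monoms_def wt_of_monom monom_weight_def)
qed

lemma weight_basis_monoms: "weight_basis (n + p + q) (levi_act n p q) (monoms n p q) (wt_of n p q)"
proof
  show "cfun.independent (monoms n p q)" by (rule independent_monoms)
  fix b assume b: "b \<in> monoms n p q"
  have "root_at (n + p + q) ` nc_index n p q \<subseteq> weights (n + p + q)"
  proof clarify
    fix i j assume "(i, j) \<in> nc_index n p q"
    then have "i < j \<and> j < n + p + q" using nc_index_less by fastforce
    then show "root_at (n + p + q) (i, j) \<in> weights (n + p + q)" by (intro root_at_in_weights) simp_all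
  qed
  then show "wt_of n p q b \<in> weights (n + p + q)"
    unfolding wt_of_def monom_weight_def by (rule neg_sum_in_weights)
next
  fix \<xi> show "finite {b \<in> monoms n p q. wt_of n p q b = \<xi>}"
    by (rule iffD1[OF bij_betw_finite[OF bij_betw_weight_fibre] finite_partitions[OF finite_nc_index root_at_nc_pos]])
qed (rule levi_act_monoms)

section \<open>The character identity\<close>

theorem lemma6:
  fixes n p q :: nat
  assumes "n \<ge> 1" and "p \<ge> 1" and "q \<ge> 1"
  shows "noncompact_pos_roots n p q =
           {eps (n + p + q) i - eps (n + p + q) (p + k) | i k. 1 \<le> i \<and> i \<le> p \<and> 1 \<le> k \<and> k \<le> n} \<union>
           {eps (n + p + q) (p + k) - eps (n + p + q) (p + n + j) | k j.
              1 \<le> k \<and> k \<le> n \<and> 1 \<le> j \<and> j \<le> q} \<and>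
         has_character (n + p + q) (levi_act n p q) (poly_V n p q) \<and>
         Delta n p q \<in> Units (series_ring (n + p + q)) \<and>
         inv\<^bsub>series_ring (n + p + q)\<^esub> (Delta n p q) =
           ch (n + p + q) (levi_act n p q) (poly_V n p q)"
proof -
  let ?N = "n + p + q" and ?J = "nc_index n p q"
  let ?R = "series_ring ?N" and ?P = "partition_series (root_at ?N) ?J"
  interpret R: cring ?R by (rule cring_series_ring)
  interpret W: weight_basis ?N "levi_act n p q" "monoms n p q" "wt_of n p q" by (rule weight_basis_monoms)
  have ch: "ch ?N (levi_act n p q) (poly_V n p q) = ?P"
    unfolding poly_V_eq_span
    by (auto simp: fun_eq_iff W.ch_eq partition_series_def bij_betw_same_card[OF bij_betw_weight_fibre])
  have fac: "(\<lambda>\<alpha>. \<one>\<^bsub>?R\<^esub> \<ominus>\<^bsub>?R\<^esub> fexp (- \<alpha>)) \<in> root_at ?N ` ?J \<rightarrow> carrier ?R"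
    using root_at_nc_pos[of n p q]
    by (intro Pi_I R.minus_closed fexp_closed neg_root_in_neg_cone) (blast intro: R.one_closed)+
  have inj: "inj_on (root_at ?N) ?J"
    by (rule inj_on_subset[OF inj_on_root_at]) (use nc_index_less in fastforce)
  have Delta: "Delta n p q = finprod ?R (\<lambda>x. \<one>\<^bsub>?R\<^esub> \<ominus>\<^bsub>?R\<^esub> fexp (- root_at ?N x)) ?J"
    unfolding Delta_def noncompact_pos_roots_eq using R.finprod_reindex[OF fac inj] by simp
  have "Delta n p q \<in> carrier ?R"
    unfolding Delta_def noncompact_pos_roots_eq using fac by (rule R.finprod_closed)
  moreover have P: "?P \<in> carrier ?R"
    by (rule partition_series_closed[OF finite_nc_index root_at_nc_pos])
  moreover have 1: "Delta n p q \<otimes>\<^bsub>?R\<^esub> ?P = \<one>\<^bsub>?R\<^esub>"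
    unfolding Delta by (rule prod_one_minus_exp_mult_partition_series[OF finite_nc_index root_at_nc_pos])
  moreover from this have 2: "?P \<otimes>\<^bsub>?R\<^esub> Delta n p q = \<one>\<^bsub>?R\<^esub>" by (simp only: comm_series_ring)
  ultimately have "Delta n p q \<in> Units ?R" "?P = inv\<^bsub>?R\<^esub> Delta n p q"
    unfolding Units_def by (blast, intro R.inv_unique')
  moreover have "has_character ?N (levi_act n p q) (poly_V n p q)"
    unfolding poly_V_eq_span by (rule W.has_character)
  ultimately show ?thesis
    unfolding ch noncompact_pos_roots_eq root_at_nc_index_eq[symmetric] by (intro conjI) simp_all
qed

end
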